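(* If $d$ is an internal degree, then every separable Banach space that is $d$-large and asymptotically $d$-small is ergodic.
   Context: All Banach spaces are real. "Banach space" means infinite-dimensional Banach space unless finite dimension is explicitly allowed. Degrees. An approximation pair is a pair $(X,F)$ where $X$ is a finite- or infinite-dimensional Banach space and $F$ is a finite-dimensional subspace of $X$. A morphism from $(X,F)$ to $(Y,G)$ is a pair $\varphi=(S,T)$ of bounded linear operators $S\colon G\to F$, $T\colon X\to Y$ such that $T(S(g))=g$ for all $g\in G$; its norm is $\|\varphi\|=\|S\|\cdot\|T\|$ if $G\neq\{0\}$ and $\|\varphi\|=1$ if $G=\{0\}$. A degree is a map $d$ assigning to every approximation pair $(X,F)$ a number $d(X,F)\in[0,\infty)$, for which there is a function $K_d\colon[1,\infty)\times[0,\infty)\to[0,\infty)$, non-decreasing in both variables, with $\lim_{s\to1}K_d(s,t)=t$ for all $t\ge 0$, such that $d(Y,G)\le K_d(\|\varphi\|,d(X,F))$ for every morphism $\varphi\colon(X,F)\to(Y,G)$. The degree is internal if $d(X,F)$ depends only on $F$. A space $X$ is $d$-small if $\sup_F d(X,F)<\infty$, the supremum being over all finite-dimensional subspaces $F$ of $X$, and $d$-large otherwise. $X$ is asymptotically $d$-small if there is a constant $K$ such that for every $n\in\mathbb N$ there is a finite-codimensional closed subspace $X_n\subseteq X$ such that every $n$-dimensional subspace $F\subseteq X_n$ satisfies $d(X,F)\le K$. Ergodicity. For separable $X$, let $\mathrm{Sub}(X)$ be the set of all closed linear subspaces of $X$ (finite- or infinite-dimensional) with the Effros Borel structure, i.e.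 the $\sigma$-algebra generated by the sets $\{Y\mid Y\cap U\neq\varnothing\}$, $U\subseteq X$ open; it is a standard Borel space. $\mathbf E_0$ is the equivalence relation on $\{0,1\}^{\mathbb N}$ relating two sequences iff they are eventually equal. A separable Banach space $X$ is ergodic if there is a Borel map $f\colon\{0,1\}^{\mathbb N}\to\mathrm{Sub}(X)$ such that for all $x,y$: $x\,\mathbf E_0\,y$ iff $f(x)$ and $f(y)$ are linearly isomorphic. *)

theory Defs
  imports "HOL-Analysis.Analysis"
begin

section \<open>Normed and Banach spaces as objects\<close>

text \<open>
  A degree is a function on all pairs of a Banach space and a finite-dimensional subspace, so Banach
  spaces have to be values, not types. A space consists of a linear subspace of a real vector space
  \<open>'v\<close> together with a norm on it; the linear structure is the one of \<open>'v\<close>, the norm is arbitrary.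
  The type \<open>'v\<close> is a parameter and plays the role of a universe: up to linear isometry, the Banach
  spaces over \<open>'v\<close> are exactly those whose algebraic dimension is at most that of \<open>'v\<close>.
\<close>

record 'v nspace =
  carr :: "'v set"
  nrm :: "'v \<Rightarrow> real"

text \<open>
  The norm is required to vanish off the carrier, so that a normed space determines its
  representation, and so that \<open>ndist\<close> is nonnegative and symmetric on all of \<open>'v\<close>, as
  \<^locale>\<open>Metric_space\<close> demands.
\<close>

definition normed_space :: "'v::real_vector nspace \<Rightarrow> bool" where
  "normed_space X \<longleftrightarrow>
     subspace (carr X) \<and>
     (\<forall>x. x \<notin> carr X \<longrightarrow> nrm X x = 0) \<and>
     (\<forall>x\<in>carr X. 0 \<le> nrm X x \<and> (nrm X x = 0 \<longleftrightarrow> x = 0)) \<and>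
     (\<forall>x\<in>carr X. \<forall>c. nrm X (c *\<^sub>R x) = \<bar>c\<bar> * nrm X x) \<and>
     (\<forall>x\<in>carr X. \<forall>y\<in>carr X. nrm X (x + y) \<le> nrm X x + nrm X y)"

definition ndist :: "'v::real_vector nspace \<Rightarrow> 'v \<Rightarrow> 'v \<Rightarrow> real" where
  "ndist X x y = nrm X (x - y)"

definition ntop :: "'v::real_vector nspace \<Rightarrow> 'v topology" where
  "ntop X = Metric_space.mtopology (carr X) (ndist X)"

lemma Metric_space_ndist:
  fixes X :: "'v::real_vector nspace"
  assumes "normed_space X"
  shows "Metric_space (carr X) (ndist X)"
proof -
  have sub: "subspace (carr X)"
    and out: "\<And>x. x \<notin> carr X \<Longrightarrow> nrm X x = 0"
    and pos: "\<And>x. x \<in> carr X \<Longrightarrow> 0 \<le> nrm X x \<and> (nrm X x = 0 \<longleftrightarrow> x = 0)"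
    and scale: "\<And>x c. x \<in> carr X \<Longrightarrow> nrm X (c *\<^sub>R x) = \<bar>c\<bar> * nrm X x"
    and tri: "\<And>x y. x \<in> carr X \<Longrightarrow> y \<in> carr X \<Longrightarrow> nrm X (x + y) \<le> nrm X x + nrm X y"
    using assms unfolding normed_space_def by auto
  have neg: "nrm X (- x) = nrm X x" for x
  proof (cases "x \<in> carr X")
    case True
    then show ?thesis using scale[of x "-1"] by simp
  next
    case False
    then have "- x \<notin> carr X" using subspace_neg[OF sub, of "- x"] by auto
    then show ?thesis using False out by simp
  qed
  show ?thesis
  proof
    fix x y
    show "0 \<le> ndist X x y"
      unfolding ndist_def using pos out by (cases "x - y \<in> carr X") auto
    show "ndist X x y = ndist X y x"
      unfolding ndist_def using neg[of "x - y"] by simp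
  next
    fix x y assume "x \<in> carr X" "y \<in> carr X"
    then show "ndist X x y = 0 \<longleftrightarrow> x = y"
      unfolding ndist_def using pos[of "x - y"] subspace_diff[OF sub] by simp
  next
    fix x y z assume "x \<in> carr X" "y \<in> carr X" "z \<in> carr X"
    then show "ndist X x z \<le> ndist X x y + ndist X y z"
      unfolding ndist_def using tri[of "x - y" "y - z"] subspace_diff[OF sub] by simp
  qed
qed

text \<open>Finite dimension is allowed here; infinite dimension is always stated separately.\<close>

definition banach_space :: "'v::real_vector nspace \<Rightarrow> bool" where
  "banach_space X \<longleftrightarrow> normed_space X \<and> Metric_space.mcomplete (carr X) (ndist X)"

lemma banach_space_type:
  "banach_space \<lparr>carr = UNIV, nrm = (norm :: 'a::banach \<Rightarrow> real)\<rparr>"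
proof -
  have "ndist \<lparr>carr = UNIV, nrm = (norm :: 'a \<Rightarrow> real)\<rparr> = dist"
    by (intro ext) (simp add: ndist_def dist_norm)
  then show ?thesis
    unfolding banach_space_def normed_space_def
    by (simp add: norm_triangle_ineq mcomplete_iff_complete complete_UNIV)
qed

definition findim :: "'v::real_vector set \<Rightarrow> bool" where
  "findim V \<longleftrightarrow> (\<exists>B. finite B \<and> V \<subseteq> span B)"

definition restrict_nspace :: "'v::real_vector nspace \<Rightarrow> 'v set \<Rightarrow> 'v nspace" where
  "restrict_nspace X F = \<lparr>carr = F, nrm = (\<lambda>x. if x \<in> F then nrm X x else 0)\<rparr>"

definition separable_nspace :: "'v::real_vector nspace \<Rightarrow> bool" where
  "separable_nspace X \<longleftrightarrow> separable_space (ntop X)"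

definition closed_subspace :: "'v::real_vector nspace \<Rightarrow> 'v set \<Rightarrow> bool" where
  "closed_subspace X Y \<longleftrightarrow> subspace Y \<and> Y \<subseteq> carr X \<and> closedin (ntop X) Y"

definition fincodim :: "'v::real_vector nspace \<Rightarrow> 'v set \<Rightarrow> bool" where
  "fincodim X Y \<longleftrightarrow> (\<exists>B. finite B \<and> span (Y \<union> B) = carr X)"


section \<open>Bounded operators\<close>

text \<open>Operators are functions on \<open>'v\<close> of which only the values on the domain space matter.\<close>

definition bounded_op :: "'v::real_vector nspace \<Rightarrow> 'v nspace \<Rightarrow> ('v \<Rightarrow> 'v) \<Rightarrow> bool" where
  "bounded_op X Y T \<longleftrightarrow>
     T ` carr X \<subseteq> carr Y \<and>
     (\<forall>x\<in>carr X. \<forall>y\<in>carr X. T (x + y) = T x + T y) \<and>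
     (\<forall>x\<in>carr X. \<forall>c. T (c *\<^sub>R x) = c *\<^sub>R T x) \<and>
     (\<exists>C. \<forall>x\<in>carr X. nrm Y (T x) \<le> C * nrm X x)"

text \<open>As in \<^const>\<open>onorm\<close>, the point \<open>x = 0\<close> contributes the value \<open>0 / 0 = 0\<close>.\<close>

definition op_norm :: "'v::real_vector nspace \<Rightarrow> 'v nspace \<Rightarrow> ('v \<Rightarrow> 'v) \<Rightarrow> real" where
  "op_norm X Y T = (SUP x\<in>carr X. nrm Y (T x) / nrm X x)"

definition isomorphic_nspace :: "'v::real_vector nspace \<Rightarrow> 'v nspace \<Rightarrow> bool" where
  "isomorphic_nspace X Y \<longleftrightarrow>
     (\<exists>S T. bounded_op X Y S \<and> bounded_op Y X T \<and>
        (\<forall>x\<in>carr X. T (S x) = x) \<and> (\<forall>y\<in>carr Y. S (T y) = y))"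


section \<open>Degrees\<close>

definition approx_pair :: "'v::real_vector nspace \<Rightarrow> 'v set \<Rightarrow> bool" where
  "approx_pair X F \<longleftrightarrow> banach_space X \<and> subspace F \<and> F \<subseteq> carr X \<and> findim F"

definition pair_morphism ::
  "'v::real_vector nspace \<Rightarrow> 'v set \<Rightarrow> 'v nspace \<Rightarrow> 'v set \<Rightarrow> ('v \<Rightarrow> 'v) \<Rightarrow> ('v \<Rightarrow> 'v) \<Rightarrow> bool" where
  "pair_morphism X F Y G S T \<longleftrightarrow>
     bounded_op (restrict_nspace Y G) (restrict_nspace X F) S \<and>
     bounded_op X Y T \<and>
     (\<forall>g\<in>G. T (S g) = g)"

definition morphism_norm ::
  "'v::real_vector nspace \<Rightarrow> 'v set \<Rightarrow> 'v nspace \<Rightarrow> 'v set \<Rightarrow> ('v \<Rightarrow> 'v) \<Rightarrow> ('v \<Rightarrow> 'v) \<Rightarrow> real" where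
  "morphism_norm X F Y G S T =
     (if G = {0} then 1
      else op_norm (restrict_nspace Y G) (restrict_nspace X F) S * op_norm X Y T)"

definition degree_modulus :: "(real \<Rightarrow> real \<Rightarrow> real) \<Rightarrow> bool" where
  "degree_modulus K \<longleftrightarrow>
     (\<forall>s\<ge>1. \<forall>t\<ge>0. 0 \<le> K s t) \<and>
     (\<forall>t\<ge>0. mono_on {1..} (\<lambda>s. K s t)) \<and>
     (\<forall>s\<ge>1. mono_on {0..} (K s)) \<and>
     (\<forall>t\<ge>0. ((\<lambda>s. K s t) \<longlongrightarrow> t) (at 1 within {1..}))"

definition is_degree :: "('v::real_vector nspace \<Rightarrow> 'v set \<Rightarrow> real) \<Rightarrow> bool" where
  "is_degree d \<longleftrightarrow>
     (\<forall>X F. approx_pair X F \<longrightarrow> 0 \<le> d X F) \<and>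
     (\<exists>K. degree_modulus K \<and>
        (\<forall>X F Y G S T.
           approx_pair X F \<longrightarrow> approx_pair Y G \<longrightarrow> pair_morphism X F Y G S T \<longrightarrow>
           d Y G \<le> K (morphism_norm X F Y G S T) (d X F)))"

text \<open>Here \<open>F\<close> is a normed space in its own right, with the norm induced from \<open>X\<close>.\<close>

definition internal_degree :: "('v::real_vector nspace \<Rightarrow> 'v set \<Rightarrow> real) \<Rightarrow> bool" where
  "internal_degree d \<longleftrightarrow>
     is_degree d \<and>
     (\<exists>\<delta>. \<forall>X F. approx_pair X F \<longrightarrow> d X F = \<delta> (restrict_nspace X F))"

definition d_small :: "('v::real_vector nspace \<Rightarrow> 'v set \<Rightarrow> real) \<Rightarrow> 'v nspace \<Rightarrow> bool" where
  "d_small d X \<longleftrightarrow> bdd_above {d X F |F. approx_pair X F}"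

abbreviation d_large :: "('v::real_vector nspace \<Rightarrow> 'v set \<Rightarrow> real) \<Rightarrow> 'v nspace \<Rightarrow> bool" where
  "d_large d X \<equiv> \<not> d_small d X"

definition asymptotically_d_small ::
  "('v::real_vector nspace \<Rightarrow> 'v set \<Rightarrow> real) \<Rightarrow> 'v nspace \<Rightarrow> bool" where
  "asymptotically_d_small d X \<longleftrightarrow>
     (\<exists>K. \<forall>n::nat. \<exists>Y. closed_subspace X Y \<and> fincodim X Y \<and>
        (\<forall>F. subspace F \<and> F \<subseteq> Y \<and> findim F \<and> dim F = n \<longrightarrow> d X F \<le> K))"


section \<open>Ergodicity\<close>

definition Sub :: "'v::real_vector nspace \<Rightarrow> 'v set set" where
  "Sub X = {Y. closed_subspace X Y}"

definition effros :: "'v::real_vector nspace \<Rightarrow> 'v set measure" where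
  "effros X = sigma (Sub X) {{Y \<in> Sub X. Y \<inter> U \<noteq> {}} |U. openin (ntop X) U}"

definition E0 :: "(nat \<Rightarrow> bool) \<Rightarrow> (nat \<Rightarrow> bool) \<Rightarrow> bool" where
  "E0 x y \<longleftrightarrow> (\<forall>\<^sub>F n in sequentially. x n = y n)"

text \<open>The Cantor space is \<^typ>\<open>nat \<Rightarrow> bool\<close> with the product topology of the library.\<close>

definition ergodic :: "'v::real_vector nspace \<Rightarrow> bool" where
  "ergodic X \<longleftrightarrow>
     (\<exists>f \<in> (borel :: (nat \<Rightarrow> bool) measure) \<rightarrow>\<^sub>M effros X.
        \<forall>x y. E0 x y \<longleftrightarrow>
          isomorphic_nspace (restrict_nspace X (f x)) (restrict_nspace X (f y)))"

end

theory Submission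
  imports Defs
begin

text \<open>
  For a finite-dimensional subspace \<open>F\<close> of \<open>X\<close> write \<open>deg F\<close> for \<open>d X F\<close>. Since \<open>d\<close> is internal, an
  isomorphism from \<open>F\<close> onto another finite-dimensional subspace \<open>G\<close> bounds \<open>deg F\<close> by \<open>deg G\<close> and the
  distortion of the isomorphism (\<open>internal_degree_embeds\<close>).

  Everything rests on the remark that finitely many dimensions can be moved cheaply. If \<open>W\<close> is an
  infinite-dimensional closed subspace and \<open>E\<close> is a finite-dimensional space contained in \<open>W\<close> plus
  \<open>m\<close> further vectors, then \<open>E\<close> is isomorphic to a subspace of \<open>W\<close> with a distortion that depends on
  \<open>m\<close> only, whatever the dimension of \<open>E\<close> (\<open>embeds_into_fincodim\<close>). So a \<open>d\<close>-large space stays large in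
  every closed subspace of finite codimension (\<open>deg_large_fincodim\<close>).

  One chooses successively pairs of finite independent sets \<open>P n\<close> and \<open>Q n\<close> of equal size
  (\<open>block_sequence_exists\<close>). First \<open>P n\<close> is chosen so that its span has an enormous degree, compared
  with the number of vectors chosen before. Asymptotic smallness, for the dimension of that span,
  provides a closed subspace \<open>W n\<close> of finite codimension; \<open>Q n\<close> and all later blocks are chosen
  inside \<open>W n\<close>, and all later blocks also inside a closed subspace of finite codimension that meets
  the span of the earlier ones trivially, which exists by the Hahn--Banach theorem
  (\<open>closed_fincodim_missing_findim\<close>). The space attached to a binary sequence \<open>x\<close> is the closed span
  of the blocks \<open>P n\<close> with \<open>x n\<close> and \<open>Q n\<close> with \<open>\<not> x n\<close>.

  If \<open>x\<close> and \<open>y\<close> agree from some index on, their spaces consist of a common closed tail and complements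
  of the same finite dimension, so they are isomorphic (\<open>E0_imp_isomorphic\<close>). Conversely, let the
  spaces of \<open>x\<close> and \<open>y\<close> be isomorphic, and let \<open>n\<close> be an index with \<open>x n\<close> and \<open>\<not> y n\<close>. The image of the
  span of \<open>P n\<close> lies in \<open>W n\<close> plus the few vectors chosen before stage \<open>n\<close>, hence can be moved into
  \<open>W n\<close>, where spaces of its dimension have a bounded degree. By the choice of \<open>P n\<close> this is
  impossible for large \<open>n\<close> (\<open>isomorphic_imp_eventually_le\<close>), and by symmetry \<open>x\<close> and \<open>y\<close> are eventually
  equal. The map is Borel because the preimages of the generating sets of the Effros structure are
  even open (\<open>open_tail_meets\<close>).
\<close>

section \<open>Linear algebra\<close>

lemma span_subspace_id:
  fixes U :: "'v::real_vector set"
  shows "subspace U \<Longrightarrow> span U = U"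
  by (rule span_eq_iff[THEN iffD2])

text \<open>
  Adding one vector to \<open>S\<close> adds at most one dimension to the part of \<open>U\<close> that lies in the span of
  \<open>S\<close>. This drives the inductions over finite codimension.
\<close>

lemma subspace_in_span_insert:
  fixes U :: "'v::real_vector set"
  assumes U: "subspace U" and le: "U \<subseteq> span (insert b S)"
  shows "U \<subseteq> span S \<or> (\<exists>e\<in>U. e \<notin> span S \<and> U = span (insert e (U \<inter> span S)))"
proof (cases "U \<subseteq> span S")
  case False
  then obtain e where e: "e \<in> U" "e \<notin> span S" by auto
  obtain t where t: "e - t *\<^sub>R b \<in> span S"
    using le e span_breakdown_eq[of e b S] by blast
  have t0: "t \<noteq> 0" using t e by auto
  have "u \<in> span (insert e (U \<inter> span S))" if u: "u \<in> U" for u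
  proof -
    obtain s where s: "u - s *\<^sub>R b \<in> span S"
      using le u span_breakdown_eq[of u b S] by blast
    \<comment> \<open>The multiple of \<open>e\<close> is chosen to cancel the \<open>b\<close>-coordinate of \<open>u\<close>.\<close>
    have "(u - s *\<^sub>R b) - (s / t) *\<^sub>R (e - t *\<^sub>R b) \<in> span S"
      by (rule span_diff[OF s span_scale[OF t]])
    then have "u - (s / t) *\<^sub>R e \<in> span S" using t0 by (simp add: algebra_simps)
    moreover have "u - (s / t) *\<^sub>R e \<in> U" using U u e by (simp add: subspace_diff subspace_scale)
    ultimately show ?thesis unfolding span_breakdown_eq
      by (intro exI[of _ "s / t"] span_base) auto
  qed
  moreover have "span (insert e (U \<inter> span S)) \<subseteq> U"
    using e U by (intro span_minimal) auto
  ultimately show ?thesis using e by auto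
qed auto

lemma findim_basis:
  fixes V :: "'v::real_vector set"
  assumes "findim V" "subspace V"
  obtains B where "finite B" "independent B" "span B = V" "card B = dim V"
proof -
  obtain C where C: "finite C" "V \<subseteq> span C" using assms unfolding findim_def by auto
  obtain B where B: "B \<subseteq> V" "independent B" "V \<subseteq> span B" "card B = dim V"
    using basis_exists by blast
  have "finite B" using independent_span_bound[OF C(1) B(2)] B(1) C(2) by auto
  moreover have "span B = V" using B assms(2) span_minimal by blast
  ultimately show ?thesis using B that by blast
qed

lemma not_findim_independent:
  fixes V :: "'v::real_vector set"
  assumes "\<not> findim V"
  obtains B where "B \<subseteq> V" "independent B" "finite B" "card B = n"
proof -
  obtain C where C: "C \<subseteq> V" "independent C" "V \<subseteq> span C"
    using maximal_independent_subset by blast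
  then have "infinite C" using assms unfolding findim_def by auto
  then obtain B where "finite B" "card B = n" "B \<subseteq> C" using infinite_arbitrarily_large by blast
  then show ?thesis using that[of B] C independent_mono by blast
qed

lemma findim_image:
  assumes "linear \<phi>" "findim V"
  shows "findim (\<phi> ` V)"
proof -
  obtain B where B: "finite B" "V \<subseteq> span B" using assms(2) unfolding findim_def by auto
  have "\<phi> ` V \<subseteq> span (\<phi> ` B)" using B(2) assms(1) by (metis image_mono linear_span_image)
  then show ?thesis using B(1) unfolding findim_def by blast
qed

lemma findim_mono: "findim W \<Longrightarrow> V \<subseteq> W \<Longrightarrow> findim V"
  unfolding findim_def by blast

lemma linear_functional_off_subspace:
  fixes e :: "'v::real_vector"
  assumes H: "subspace H" and e: "e \<notin> H"
  obtains \<tau> :: "'v \<Rightarrow> real" where "linear \<tau>" "\<And>h. h \<in> H \<Longrightarrow> \<tau> h = 0" "\<tau> e = 1"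
proof -
  obtain B where B: "B \<subseteq> H" "independent B" "H \<subseteq> span B" using maximal_independent_subset by blast
  have sp: "span B = H" using B H span_minimal by blast
  have ind: "independent (insert e B)" using B(2) e sp by (simp add: independent_insert)
  obtain \<tau> :: "'v \<Rightarrow> real"
    where \<tau>: "linear \<tau>" "\<forall>x\<in>insert e B. \<tau> x = (if x = e then 1 else 0)"
    using linear_independent_extend[OF ind, of "\<lambda>x. if x = e then 1 else 0"] by auto
  have "\<tau> h = 0" if "h \<in> H" for h
  proof (rule linear_eq_0_on_span[OF \<tau>(1)])
    show "h \<in> span B" using that sp by simp
    show "\<And>x. x \<in> B \<Longrightarrow> \<tau> x = 0" using \<tau>(2) e B(1) by auto
  qed
  then show ?thesis using that \<tau> by auto
qed

lemma span_Union_finite_stage: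
  fixes u :: "'v::real_vector"
  assumes "u \<in> span (\<Union>i. C i)"
  obtains m :: nat where "u \<in> span (\<Union>i<m. C i)"
proof -
  obtain t r where t: "finite t" "t \<subseteq> (\<Union>i. C i)" and u: "u = (\<Sum>a\<in>t. r a *\<^sub>R a)"
    using assms unfolding span_explicit by blast
  obtain g where g: "\<And>a. a \<in> t \<Longrightarrow> a \<in> C (g a)" using t(2) by (metis UN_E subsetD)
  obtain m where m: "\<forall>i\<in>g ` t. i < m" using t(1) finite_nat_set_iff_bounded[of "g ` t"] by auto
  have "t \<subseteq> (\<Union>i<m. C i)" using g m by blast
  then have "u \<in> span (\<Union>i<m. C i)" unfolding u by (intro span_sum span_scale span_base) blast
  then show ?thesis by (rule that)
qed

section \<open>Closed subspaces of a normed space\<close>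

locale nsp =
  fixes X :: "'v::real_vector nspace"
  assumes normed: "normed_space X"
begin

abbreviation N :: "'v \<Rightarrow> real" where "N \<equiv> nrm X"

lemma subspace_carr: "subspace (carr X)"
  and N_off: "x \<notin> carr X \<Longrightarrow> N x = 0"
  and N_scale: "x \<in> carr X \<Longrightarrow> N (c *\<^sub>R x) = \<bar>c\<bar> * N x"
  and N_add: "x \<in> carr X \<Longrightarrow> y \<in> carr X \<Longrightarrow> N (x + y) \<le> N x + N y"
  using normed unfolding normed_space_def by auto

lemma N_nonneg: "0 \<le> N x"
  using normed unfolding normed_space_def by (cases "x \<in> carr X") auto

lemma N_eq_0: "x \<in> carr X \<Longrightarrow> N x = 0 \<longleftrightarrow> x = 0"
  using normed unfolding normed_space_def by auto

lemma N_pos: "x \<in> carr X \<Longrightarrow> x \<noteq> 0 \<Longrightarrow> 0 < N x"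
  using N_nonneg[of x] N_eq_0[of x] by auto

lemmas carr_simps =
  subspace_add[OF subspace_carr] subspace_diff[OF subspace_carr]
  subspace_scale[OF subspace_carr] subspace_0[OF subspace_carr]

lemma N_zero: "N 0 = 0"
  using N_eq_0[of 0] carr_simps by auto

lemma N_minus: "x \<in> carr X \<Longrightarrow> N (- x) = N x"
  using N_scale[of x "-1"] by simp

lemma N_commute: "x \<in> carr X \<Longrightarrow> y \<in> carr X \<Longrightarrow> N (x - y) = N (y - x)"
  using N_minus[of "x - y"] carr_simps by simp

lemma N_triangle:
  "x \<in> carr X \<Longrightarrow> y \<in> carr X \<Longrightarrow> z \<in> carr X \<Longrightarrow> N (x - z) \<le> N (x - y) + N (y - z)"
  using N_add[of "x - y" "y - z"] carr_simps by simp

lemma N_diff: "x \<in> carr X \<Longrightarrow> y \<in> carr X \<Longrightarrow> N (x - y) \<le> N x + N y"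
  using N_add[of x "- y"] N_minus[of y] carr_simps(3)[of y "-1"] by simp

lemma metric: "Metric_space (carr X) (ndist X)"
  using normed by (rule Metric_space_ndist)

lemma openin_ntop:
  "openin (ntop X) U \<longleftrightarrow> U \<subseteq> carr X \<and> (\<forall>u\<in>U. \<exists>r>0. \<forall>y\<in>carr X. N (u - y) < r \<longrightarrow> y \<in> U)"
proof -
  interpret Metric_space "carr X" "ndist X" by (rule metric)
  show ?thesis unfolding ntop_def openin_mtopology mball_def ndist_def by blast
qed

lemma closedin_ntop:
  "closedin (ntop X) Y \<longleftrightarrow>
    Y \<subseteq> carr X \<and> (\<forall>x\<in>carr X. (\<forall>\<epsilon>>0. \<exists>y\<in>Y. N (x - y) < \<epsilon>) \<longrightarrow> x \<in> Y)"
proof -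
  interpret Metric_space "carr X" "ndist X" by (rule metric)
  show ?thesis unfolding ntop_def closedin_metric mball_def ndist_def disjnt_iff by blast
qed

lemma closed_subspaceD:
  assumes "closed_subspace X Y"
  shows "subspace Y" "Y \<subseteq> carr X"
    "\<And>x. x \<in> carr X \<Longrightarrow> (\<And>\<epsilon>. \<epsilon> > 0 \<Longrightarrow> \<exists>y\<in>Y. N (x - y) < \<epsilon>) \<Longrightarrow> x \<in> Y"
  using assms unfolding closed_subspace_def closedin_ntop by auto

lemma closed_subspaceI:
  assumes "subspace Y" "Y \<subseteq> carr X"
    "\<And>x. x \<in> carr X \<Longrightarrow> (\<And>\<epsilon>. \<epsilon> > 0 \<Longrightarrow> \<exists>y\<in>Y. N (x - y) < \<epsilon>) \<Longrightarrow> x \<in> Y"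
  shows "closed_subspace X Y"
  using assms unfolding closed_subspace_def closedin_ntop by auto

lemma closed_subspace_carr: "closed_subspace X (carr X)"
  by (rule closed_subspaceI) (auto simp: subspace_carr)

lemma closed_subspace_Int:
  assumes "closed_subspace X Y" "closed_subspace X Z"
  shows "closed_subspace X (Y \<inter> Z)"
  using assms unfolding closed_subspace_def by (auto simp: subspace_inter)

lemma closed_subspace_0: "closed_subspace X {0}"
proof (rule closed_subspaceI)
  fix x assume x: "x \<in> carr X" and near: "\<And>\<epsilon>. \<epsilon> > 0 \<Longrightarrow> \<exists>y\<in>{0}. N (x - y) < \<epsilon>"
  have "\<not> 0 < N x" using near[of "N x"] by auto
  then show "x \<in> {0}" using N_pos[OF x] by auto
qed (auto simp: carr_simps)

lemma closed_subspace_dist_pos: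
  assumes H: "closed_subspace X H" and v: "v \<in> carr X" "v \<notin> H"
  obtains \<rho> where "0 < \<rho>" "\<And>h. h \<in> H \<Longrightarrow> \<rho> \<le> N (v + h)"
proof -
  note H' = closed_subspaceD[OF H]
  have "\<exists>\<rho>>0. \<forall>h\<in>H. \<rho> \<le> N (v - h)"
  proof (rule ccontr)
    assume "\<not> ?thesis"
    then have "\<And>\<epsilon>. \<epsilon> > 0 \<Longrightarrow> \<exists>y\<in>H. N (v - y) < \<epsilon>" by (meson not_le)
    then show False using H'(3) v by blast
  qed
  then obtain \<rho> where \<rho>: "0 < \<rho>" "\<And>h. h \<in> H \<Longrightarrow> \<rho> \<le> N (v - h)" by auto
  have "\<rho> \<le> N (v + h)" if "h \<in> H" for h
    using \<rho>(2)[of "- h"] subspace_neg[OF H'(1) that] by simp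
  then show ?thesis using \<rho>(1) that by blast
qed

text \<open>
  By homogeneity, a lower bound for the distance of \<open>e\<close> from \<open>H\<close> makes the coordinate along \<open>e\<close> a
  bounded functional.
\<close>

lemma coordinate_bound:
  assumes H: "subspace H" "H \<subseteq> carr X" and e: "e \<in> carr X"
    and far: "\<And>h. h \<in> H \<Longrightarrow> \<rho> \<le> N (e + h)" and h: "h \<in> H"
  shows "\<bar>t\<bar> * \<rho> \<le> N (h + t *\<^sub>R e)"
proof (cases "t = 0")
  case False
  have "\<rho> \<le> N (e + (1 / t) *\<^sub>R h)" using far h H subspace_scale by blast
  then have "\<bar>t\<bar> * \<rho> \<le> \<bar>t\<bar> * N (e + (1 / t) *\<^sub>R h)" by (simp add: mult_left_mono)
  also have "\<dots> = N (t *\<^sub>R (e + (1 / t) *\<^sub>R h))"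
    using h H e by (intro N_scale[symmetric]) (auto simp: carr_simps)
  also have "t *\<^sub>R (e + (1 / t) *\<^sub>R h) = h + t *\<^sub>R e" using False by (simp add: algebra_simps)
  finally show ?thesis .
qed (simp add: N_nonneg)

text \<open>
  If \<open>h n + t n e\<close> converges, so does \<open>t n\<close>, because the coordinate along \<open>e\<close> is bounded; then \<open>h n\<close>
  converges as well, to a point of the closed subspace \<open>H\<close>.
\<close>

lemma closed_subspace_span_insert:
  assumes H: "closed_subspace X H" and e: "e \<in> carr X"
  shows "closed_subspace X (span (insert e H))"
proof (cases "e \<in> H")
  case True
  then have "span (insert e H) = H"
    using closed_subspaceD(1)[OF H] by (simp add: insert_absorb span_subspace_id)
  then show ?thesis using H by simp
next
  case False
  note H' = closed_subspaceD[OF H]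
  obtain \<rho> where \<rho>: "0 < \<rho>" "\<And>h. h \<in> H \<Longrightarrow> \<rho> \<le> N (e + h)"
    using closed_subspace_dist_pos[OF H e False] by blast
  show ?thesis
  proof (rule closed_subspaceI)
    show "span (insert e H) \<subseteq> carr X"
      using e H' by (intro span_minimal) (auto simp: subspace_carr)
  next
    fix x assume x: "x \<in> carr X"
      and near: "\<And>\<epsilon>. \<epsilon> > 0 \<Longrightarrow> \<exists>y\<in>span (insert e H). N (x - y) < \<epsilon>"
    have "\<exists>h t. h \<in> H \<and> N (x - (h + t *\<^sub>R e)) < inverse (real (Suc n))" for n
    proof -
      obtain y where y: "y \<in> span (insert e H)" "N (x - y) < inverse (real (Suc n))"
        using near[of "inverse (real (Suc n))"] by auto
      then obtain t where "y - t *\<^sub>R e \<in> H"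
        using H'(1) by (auto simp: span_breakdown_eq span_subspace_id)
      then show ?thesis using y by (intro exI[of _ "y - t *\<^sub>R e"] exI[of _ t]) auto
    qed
    then obtain h t where h: "\<And>n. h n \<in> H"
      and ht: "\<And>n. N (x - (h n + t n *\<^sub>R e)) < inverse (real (Suc n))"
      by metis
    have hc: "h n \<in> carr X" for n using h H' by auto
    have diff: "\<bar>t m - t n\<bar> * \<rho> < inverse (real (Suc m)) + inverse (real (Suc n))" for m n
    proof -
      have "\<bar>t m - t n\<bar> * \<rho> \<le> N ((h m - h n) + (t m - t n) *\<^sub>R e)"
        by (rule coordinate_bound[OF H'(1,2) e \<rho>(2)]) (use subspace_diff[OF H'(1) h h] in auto)
      also have "(h m - h n) + (t m - t n) *\<^sub>R e = (h m + t m *\<^sub>R e) - (h n + t n *\<^sub>R e)"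
        by (simp add: algebra_simps)
      also have "N \<dots> \<le> N ((h m + t m *\<^sub>R e) - x) + N (x - (h n + t n *\<^sub>R e))"
        using hc e x by (intro N_triangle) (auto simp: carr_simps)
      also have "N ((h m + t m *\<^sub>R e) - x) = N (x - (h m + t m *\<^sub>R e))"
        using hc e x by (intro N_commute) (auto simp: carr_simps)
      finally show ?thesis using ht[of m] ht[of n] by linarith
    qed
    have "Cauchy t"
    proof (rule metric_CauchyI)
      fix \<epsilon> :: real assume "0 < \<epsilon>"
      then obtain M where M: "inverse (real (Suc M)) < \<epsilon> * \<rho> / 2"
        using reals_Archimedean[of "\<epsilon> * \<rho> / 2"] \<rho> by auto
      have "dist (t m) (t n) < \<epsilon>" if "m \<ge> M" "n \<ge> M" for m n
      proof -
        have "inverse (real (Suc m)) \<le> inverse (real (Suc M))"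
          "inverse (real (Suc n)) \<le> inverse (real (Suc M))" using that by auto
        then have "\<bar>t m - t n\<bar> * \<rho> < \<epsilon> * \<rho>" using diff[of m n] M by linarith
        then show ?thesis using \<rho> by (simp add: dist_real_def)
      qed
      then show "\<exists>M. \<forall>m\<ge>M. \<forall>n\<ge>M. dist (t m) (t n) < \<epsilon>" by blast
    qed
    then obtain s where s: "t \<longlonglongrightarrow> s" using real_Cauchy_convergent convergent_def by blast
    have "x - s *\<^sub>R e \<in> H"
    proof (rule H'(3))
      show "x - s *\<^sub>R e \<in> carr X" using x e by (simp add: carr_simps)
      fix \<epsilon> :: real assume \<epsilon>: "0 < \<epsilon>"
      have "(\<lambda>n. inverse (real (Suc n)) + \<bar>t n - s\<bar> * N e) \<longlonglongrightarrow> 0 + \<bar>s - s\<bar> * N e"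
        by (intro tendsto_intros s LIMSEQ_inverse_real_of_nat)
      then have "\<forall>\<^sub>F n in sequentially. inverse (real (Suc n)) + \<bar>t n - s\<bar> * N e < \<epsilon>"
        using \<epsilon> by (intro order_tendstoD(2)[of _ 0]) auto
      then obtain n where n: "inverse (real (Suc n)) + \<bar>t n - s\<bar> * N e < \<epsilon>"
        using eventually_happens trivial_limit_sequentially by blast
      have "(x - s *\<^sub>R e) - h n = (x - (h n + t n *\<^sub>R e)) + (t n - s) *\<^sub>R e"
        by (simp add: algebra_simps)
      also have "N \<dots> \<le> N (x - (h n + t n *\<^sub>R e)) + N ((t n - s) *\<^sub>R e)"
        using x hc e by (intro N_add) (auto simp: carr_simps)
      also have "\<dots> < \<epsilon>" using N_scale[OF e, of "t n - s"] ht[of n] n by simp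
      finally show "\<exists>y\<in>H. N (x - s *\<^sub>R e - y) < \<epsilon>" using h by blast
    qed
    then show "x \<in> span (insert e H)" using H'(1) by (auto simp: span_breakdown_eq span_subspace_id)
  qed simp
qed

lemma closed_subspace_span_Un:
  assumes "finite B" "B \<subseteq> carr X" and H: "closed_subspace X H"
  shows "closed_subspace X (span (H \<union> B))"
  using assms(1,2)
proof (induction B)
  case empty
  then show ?case using H closed_subspaceD(1)[OF H] by (simp add: span_subspace_id)
next
  case (insert b B)
  have "span (H \<union> insert b B) = span (insert b (span (H \<union> B)))"
  proof
    show "span (H \<union> insert b B) \<subseteq> span (insert b (span (H \<union> B)))"
      by (rule span_minimal) (auto intro: span_base)
    have "span (H \<union> B) \<subseteq> span (H \<union> insert b B)" by (rule span_mono) auto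
    then show "span (insert b (span (H \<union> B))) \<subseteq> span (H \<union> insert b B)"
      by (intro span_minimal) (auto intro: span_base)
  qed
  then show ?case using insert closed_subspace_span_insert[of "span (H \<union> B)" b] by simp
qed

lemma findim_closed_subspace:
  assumes "subspace F" "F \<subseteq> carr X" "findim F"
  shows "closed_subspace X F"
proof -
  obtain B where B: "finite B" "span B = F" using findim_basis assms by blast
  have "B \<subseteq> carr X" using B assms span_superset by blast
  then have "closed_subspace X (span ({0} \<union> B))"
    using closed_subspace_span_Un[OF B(1)] closed_subspace_0 by blast
  then show ?thesis using B by simp
qed

text \<open>
  Riesz's lemma: normalize a vector \<open>v + h0\<close> whose norm is less than twice the distance of \<open>v\<close> from
  \<open>H\<close>.
\<close>

lemma Riesz:
  assumes H: "closed_subspace X H" "H \<subseteq> U" and U: "subspace U" "U \<subseteq> carr X" and "H \<noteq> U"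
  obtains e where "e \<in> U" "N e = 1" "\<And>h. h \<in> H \<Longrightarrow> 1/2 \<le> N (e + h)"
proof -
  note H' = closed_subspaceD[OF H(1)]
  obtain v where v: "v \<in> U" "v \<notin> H" using assms by auto
  then have vc: "v \<in> carr X" using U by auto
  obtain \<rho> where \<rho>: "0 < \<rho>" "\<And>h. h \<in> H \<Longrightarrow> \<rho> \<le> N (v + h)"
    using closed_subspace_dist_pos[OF H(1) vc v(2)] by blast
  define D where "D = (INF h\<in>H. N (v + h))"
  have bdd: "bdd_below ((\<lambda>h. N (v + h)) ` H)" using \<rho> by (auto intro!: bdd_belowI)
  have ne: "H \<noteq> {}" using subspace_0[OF H'(1)] by auto
  have D: "0 < D" unfolding D_def
    using \<rho> ne by (intro less_le_trans[OF \<rho>(1)] cINF_greatest) auto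
  have "\<exists>h\<in>H. N (v + h) < 2 * D"
    using cINF_less_iff[OF ne bdd, of "2 * D"] D by (simp add: D_def)
  then obtain h0 where h0: "h0 \<in> H" "N (v + h0) < 2 * D" by auto
  define c where "c = N (v + h0)"
  have Dle: "D \<le> N (v + h)" if "h \<in> H" for h
    unfolding D_def using cINF_lower[OF bdd that] .
  have c: "0 < c" "c < 2 * D" using h0 Dle[of h0] D by (auto simp: c_def)
  define e where "e = (1 / c) *\<^sub>R (v + h0)"
  have inc: "v + h0 \<in> carr X" using vc h0 H'(2) by (intro carr_simps) auto
  have eU: "e \<in> U" using U v h0 H unfolding e_def by (meson subset_eq subspace_add subspace_scale)
  have Ne: "N e = 1" using N_scale[OF inc, of "1 / c"] c by (simp add: e_def c_def)
  have "1/2 \<le> N (e + h)" if h: "h \<in> H" for h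
  proof -
    have "v + (h0 + c *\<^sub>R h) \<in> carr X"
      using vc h0 h H'(2) by (intro carr_simps) auto
    moreover have "e + h = (1 / c) *\<^sub>R (v + (h0 + c *\<^sub>R h))"
      using c by (simp add: e_def algebra_simps)
    ultimately have "N (e + h) = N (v + (h0 + c *\<^sub>R h)) / c" using N_scale[of _ "1 / c"] c by simp
    moreover have "D \<le> N (v + (h0 + c *\<^sub>R h))"
      using h h0 H' by (intro Dle) (auto simp: subspace_add subspace_scale)
    ultimately have "D / c \<le> N (e + h)" using c by (simp add: divide_right_mono)
    moreover have "1/2 \<le> D / c" using c by (simp add: field_simps)
    ultimately show ?thesis by linarith
  qed
  then show ?thesis using that eU Ne by blast
qed

definition cl :: "'v set \<Rightarrow> 'v set" where
  "cl S = {x \<in> carr X. \<forall>\<epsilon>>0. \<exists>y\<in>S. N (x - y) < \<epsilon>}"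

lemma cl_superset: "S \<subseteq> carr X \<Longrightarrow> S \<subseteq> cl S"
  unfolding cl_def using N_zero by force

lemma cl_subset_carr: "cl S \<subseteq> carr X"
  unfolding cl_def by auto

lemma cl_minimal:
  assumes "closed_subspace X Y" "S \<subseteq> Y"
  shows "cl S \<subseteq> Y"
proof
  fix x assume "x \<in> cl S"
  then show "x \<in> Y"
    using closed_subspaceD(3)[OF assms(1), of x] assms(2) unfolding cl_def by blast
qed

lemma closed_subspace_cl:
  assumes S: "subspace S" "S \<subseteq> carr X"
  shows "closed_subspace X (cl S)"
proof (rule closed_subspaceI)
  have dense: "\<exists>y\<in>S. N (x - y) < \<epsilon>" if "x \<in> cl S" "\<epsilon> > 0" for x \<epsilon>
    using that unfolding cl_def by auto
  show "subspace (cl S)"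
  proof (rule subspaceI)
    show "0 \<in> cl S" using cl_superset[OF S(2)] subspace_0[OF S(1)] by auto
  next
    fix x y assume xy: "x \<in> cl S" "y \<in> cl S"
    then have c: "x \<in> carr X" "y \<in> carr X" using cl_subset_carr by auto
    have "\<exists>z\<in>S. N (x + y - z) < \<epsilon>" if \<epsilon>: "\<epsilon> > 0" for \<epsilon>
    proof -
      obtain u w where u: "u \<in> S" "N (x - u) < \<epsilon> / 2" and w: "w \<in> S" "N (y - w) < \<epsilon> / 2"
        using dense[of x "\<epsilon> / 2"] dense[of y "\<epsilon> / 2"] xy \<epsilon> by auto
      have "N ((x - u) + (y - w)) \<le> N (x - u) + N (y - w)"
        using c u w S(2) by (intro N_add carr_simps) auto
      moreover have "(x - u) + (y - w) = x + y - (u + w)" by simp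
      ultimately have "N (x + y - (u + w)) < \<epsilon>" using u w by simp
      then show ?thesis using subspace_add[OF S(1) u(1) w(1)] by blast
    qed
    then show "x + y \<in> cl S" unfolding cl_def using c by (auto simp: carr_simps)
  next
    fix c x assume x: "x \<in> cl S"
    then have xc: "x \<in> carr X" using cl_subset_carr by auto
    have "\<exists>z\<in>S. N (c *\<^sub>R x - z) < \<epsilon>" if \<epsilon>: "\<epsilon> > 0" for \<epsilon>
    proof -
      have pos: "0 < \<epsilon> / (\<bar>c\<bar> + 1)" using \<epsilon> by simp
      obtain u where u: "u \<in> S" "N (x - u) < \<epsilon> / (\<bar>c\<bar> + 1)" using dense[OF x pos] by auto
      have "N (c *\<^sub>R (x - u)) = \<bar>c\<bar> * N (x - u)"
        using xc u S(2) by (intro N_scale carr_simps) auto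
      also have "\<dots> \<le> (\<bar>c\<bar> + 1) * N (x - u)" by (intro mult_right_mono) (auto simp: N_nonneg)
      also have "\<dots> < \<epsilon>" using u(2) by (simp add: pos_less_divide_eq mult.commute)
      finally have "N (c *\<^sub>R x - c *\<^sub>R u) < \<epsilon>" by (simp add: algebra_simps)
      then show ?thesis using subspace_scale[OF S(1) u(1)] by blast
    qed
    then show "c *\<^sub>R x \<in> cl S" unfolding cl_def using xc by (auto simp: carr_simps)
  qed
  show "cl S \<subseteq> carr X" by (rule cl_subset_carr)
next
  fix x assume x: "x \<in> carr X" and near: "\<And>\<epsilon>. \<epsilon> > 0 \<Longrightarrow> \<exists>y\<in>cl S. N (x - y) < \<epsilon>"
  have "\<exists>z\<in>S. N (x - z) < \<epsilon>" if \<epsilon>: "\<epsilon> > 0" for \<epsilon>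
  proof -
    obtain y where y: "y \<in> cl S" "N (x - y) < \<epsilon> / 2" using near[of "\<epsilon> / 2"] \<epsilon> by auto
    obtain z where z: "z \<in> S" "N (y - z) < \<epsilon> / 2"
      using y(1) \<epsilon> unfolding cl_def by (auto dest!: spec[of _ "\<epsilon> / 2"])
    have "N (x - z) \<le> N (x - y) + N (y - z)"
      using x y z S(2) cl_subset_carr by (intro N_triangle) auto
    then have "N (x - z) < \<epsilon>" using y z by simp
    then show ?thesis using z by blast
  qed
  then show "x \<in> cl S" unfolding cl_def using x by auto
qed

section \<open>Closed subspaces of finite codimension\<close>

text \<open>
  A form of the Hahn--Banach theorem. A subspace that is maximal among those missing the open ball
  of radius \<open>N v\<close> about \<open>v\<close> is closed; were it not a complement of the line through \<open>v\<close>, it could be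
  enlarged by a vector \<open>x - (a / N v) v\<close>, where \<open>a\<close> is the value that a norm-one extension of
  \<open>z + \<kappa> v \<mapsto> \<kappa> N v\<close> may take at \<open>x\<close>.
\<close>

lemma closed_hyperplane_missing:
  assumes v: "v \<in> carr X" "v \<noteq> 0"
  obtains Z where "closed_subspace X Z" "v \<notin> Z" "span (insert v Z) = carr X"
proof -
  define \<A> where "\<A> = {Z. subspace Z \<and> Z \<subseteq> carr X \<and> (\<forall>z\<in>Z. N v \<le> N (v + z))}"
  have "\<exists>M\<in>\<A>. \<forall>Z\<in>\<A>. M \<subseteq> Z \<longrightarrow> Z = M"
  proof (rule subset_Zorn_nonempty)
    have "{0} \<in> \<A>" unfolding \<A>_def by (simp add: carr_simps)
    then show "\<A> \<noteq> {}" by auto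
  next
    fix \<C> assume ne: "\<C> \<noteq> {}" and ch: "subset.chain \<A> \<C>"
    then have in\<A>: "\<And>Z. Z \<in> \<C> \<Longrightarrow> Z \<in> \<A>" by (auto simp: subset_chain_def)
    have "subspace (\<Union>\<C>)"
    proof (rule subspaceI)
      obtain Z where "Z \<in> \<C>" using ne by auto
      then show "0 \<in> \<Union>\<C>" using in\<A>[of Z] subspace_0[of Z] unfolding \<A>_def by auto
    next
      fix x y assume "x \<in> \<Union>\<C>" "y \<in> \<Union>\<C>"
      then obtain Z Z' where Z: "Z \<in> \<C>" "Z' \<in> \<C>" "x \<in> Z" "y \<in> Z'" by auto
      have "Z \<subseteq> Z' \<or> Z' \<subseteq> Z" using ch Z by (auto simp: subset_chain_def)
      then obtain U where "U \<in> \<C>" "x \<in> U" "y \<in> U" using Z by blast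
      then show "x + y \<in> \<Union>\<C>" using in\<A>[of U] unfolding \<A>_def by (auto intro: subspace_add)
    next
      fix c x assume "x \<in> \<Union>\<C>"
      then show "c *\<^sub>R x \<in> \<Union>\<C>" using in\<A> unfolding \<A>_def by (auto intro: subspace_scale)
    qed
    then show "\<Union>\<C> \<in> \<A>" using in\<A> unfolding \<A>_def by blast
  qed
  then obtain M where M: "M \<in> \<A>" and max: "\<And>Z. Z \<in> \<A> \<Longrightarrow> M \<subseteq> Z \<Longrightarrow> Z = M" by blast
  have Msub: "subspace M" and Mc: "M \<subseteq> carr X" and far: "\<And>z. z \<in> M \<Longrightarrow> N v \<le> N (v + z)"
    using M unfolding \<A>_def by auto
  have Nv: "0 < N v" using v N_pos by auto
  have "N v \<le> N (v + x)" if x: "x \<in> cl M" for x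
  proof (rule field_le_epsilon)
    fix \<epsilon> :: real assume "0 < \<epsilon>"
    then obtain y where y: "y \<in> M" "N (x - y) < \<epsilon>" using x unfolding cl_def by auto
    have c: "x \<in> carr X" "y \<in> carr X" using x y Mc cl_subset_carr by auto
    have "N v \<le> N (v + y)" using far y by auto
    also have "v + y = (v + x) - (x - y)" by simp
    also have "N \<dots> \<le> N (v + x) + N (x - y)" using c v by (intro N_diff carr_simps)
    finally show "N v \<le> N (v + x) + \<epsilon>" using y by simp
  qed
  then have "cl M \<in> \<A>"
    unfolding \<A>_def using closed_subspaceD(1,2)[OF closed_subspace_cl[OF Msub Mc]] by auto
  then have closed: "closed_subspace X M"
    using closed_subspace_cl[OF Msub Mc] max[OF _ cl_superset[OF Mc]] by simp
  have vM: "v \<notin> M"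
    using far[of "- v"] subspace_neg[OF Msub, of v] Nv N_zero by auto
  have "carr X \<subseteq> span (insert v M)"
  proof
    fix x assume x: "x \<in> carr X"
    show "x \<in> span (insert v M)"
    proof (rule ccontr)
      assume xv: "x \<notin> span (insert v M)"
      have g: "\<kappa> * N v \<le> N (z + \<kappa> *\<^sub>R v)" if "z \<in> M" for z \<kappa>
      proof -
        have "\<kappa> * N v \<le> \<bar>\<kappa>\<bar> * N v" using Nv by (intro mult_right_mono) auto
        also have "\<dots> \<le> N (z + \<kappa> *\<^sub>R v)" using coordinate_bound[OF Msub Mc v(1) far that] .
        finally show ?thesis .
      qed
      have cross: "\<kappa> * N v - N (z + \<kappa> *\<^sub>R v - x) \<le> N (z' + \<mu> *\<^sub>R v + x) - \<mu> * N v"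
        if z: "z \<in> M" "z' \<in> M" for z z' \<kappa> \<mu>
      proof -
        have zc: "z \<in> carr X" "z' \<in> carr X" using z Mc by auto
        have "(\<kappa> + \<mu>) * N v \<le> N ((z + z') + (\<kappa> + \<mu>) *\<^sub>R v)"
          using g subspace_add[OF Msub z] by blast
        also have "(z + z') + (\<kappa> + \<mu>) *\<^sub>R v = (z + \<kappa> *\<^sub>R v - x) + (z' + \<mu> *\<^sub>R v + x)"
          by (simp add: algebra_simps)
        also have "N \<dots> \<le> N (z + \<kappa> *\<^sub>R v - x) + N (z' + \<mu> *\<^sub>R v + x)"
          using zc x v by (intro N_add carr_simps)
        finally show ?thesis by (simp add: algebra_simps)
      qed
      define L where "L = (\<lambda>(z, \<kappa>). \<kappa> * N v - N (z + \<kappa> *\<^sub>R v - x)) ` (M \<times> UNIV)"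
      define a where "a = Sup L"
      have zM: "0 \<in> M" using Msub by (rule subspace_0)
      have bdd: "bdd_above L"
        using cross[OF _ zM, of _ _ 0] unfolding L_def by (intro bdd_aboveI2) auto
      have lower: "\<kappa> * N v - N (z + \<kappa> *\<^sub>R v - x) \<le> a" if "z \<in> M" for z \<kappa>
        unfolding a_def using that by (intro cSup_upper bdd) (auto simp: L_def)
      have upper: "a \<le> N (z + \<mu> *\<^sub>R v + x) - \<mu> * N v" if "z \<in> M" for z \<mu>
        unfolding a_def using cross[OF _ that] zM
        by (intro cSup_least) (auto simp: L_def)
      have dominated: "\<kappa> * N v + t * a \<le> N (z + \<kappa> *\<^sub>R v + t *\<^sub>R x)" if z: "z \<in> M" for z \<kappa> t
      proof -
        have zc: "z \<in> carr X" using z Mc by auto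
        consider "t = 0" | "t > 0" | "t < 0" by linarith
        then show ?thesis
        proof cases
          case 1
          then show ?thesis using g[OF z] by simp
        next
          case 2
          have "a \<le> N ((1/t) *\<^sub>R z + (\<kappa>/t) *\<^sub>R v + x) - (\<kappa>/t) * N v"
            by (rule upper[OF subspace_scale[OF Msub z]])
          then have "t * (a + (\<kappa>/t) * N v) \<le> t * N ((1/t) *\<^sub>R z + (\<kappa>/t) *\<^sub>R v + x)"
            using 2 by (intro mult_left_mono) auto
          also have "\<dots> = N (t *\<^sub>R ((1/t) *\<^sub>R z + (\<kappa>/t) *\<^sub>R v + x))"
            using N_scale[of "(1/t) *\<^sub>R z + (\<kappa>/t) *\<^sub>R v + x" t] zc v x 2 by (simp add: carr_simps)
          also have "t *\<^sub>R ((1/t) *\<^sub>R z + (\<kappa>/t) *\<^sub>R v + x) = z + \<kappa> *\<^sub>R v + t *\<^sub>R x"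
            using 2 by (simp add: algebra_simps)
          finally show ?thesis using 2 by (simp add: distrib_left add.commute)
        next
          case 3
          define s where "s = - t"
          have s: "0 < s" "t = - s" using 3 by (auto simp: s_def)
          have "(\<kappa>/s) * N v - N ((1/s) *\<^sub>R z + (\<kappa>/s) *\<^sub>R v - x) \<le> a"
            by (rule lower[OF subspace_scale[OF Msub z]])
          then have "s * ((\<kappa>/s) * N v - a) \<le> s * N ((1/s) *\<^sub>R z + (\<kappa>/s) *\<^sub>R v - x)"
            using s by (intro mult_left_mono) auto
          also have "\<dots> = N (s *\<^sub>R ((1/s) *\<^sub>R z + (\<kappa>/s) *\<^sub>R v - x))"
            using N_scale[of "(1/s) *\<^sub>R z + (\<kappa>/s) *\<^sub>R v - x" s] zc v x s by (simp add: carr_simps)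
          also have "s *\<^sub>R ((1/s) *\<^sub>R z + (\<kappa>/s) *\<^sub>R v - x) = z + \<kappa> *\<^sub>R v + t *\<^sub>R x"
            using s by (simp add: algebra_simps)
          finally show ?thesis using s by (simp add: right_diff_distrib)
        qed
      qed
      define x' where "x' = x - (a / N v) *\<^sub>R v"
      have x'c: "x' \<in> carr X" unfolding x'_def using x v by (intro carr_simps)
      have x'M: "x' \<notin> M" unfolding x'_def
        using xv span_breakdown_eq[of x v M] span_base[of _ M] by blast
      have "N v \<le> N (v + u)" if u: "u \<in> span (insert x' M)" for u
      proof -
        obtain t where t: "u - t *\<^sub>R x' \<in> M"
          using u Msub by (auto simp: span_breakdown_eq span_subspace_id)
        have "(1 - t * a / N v) * N v + t * a
            \<le> N ((u - t *\<^sub>R x') + (1 - t * a / N v) *\<^sub>R v + t *\<^sub>R x)"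
          by (rule dominated[OF t])
        moreover have "(u - t *\<^sub>R x') + (1 - t * a / N v) *\<^sub>R v + t *\<^sub>R x = v + u"
          by (simp add: x'_def algebra_simps)
        ultimately show ?thesis using Nv by (simp add: field_simps)
      qed
      moreover have "span (insert x' M) \<subseteq> carr X"
        using x'c Mc by (intro span_minimal) (auto simp: subspace_carr)
      ultimately have "span (insert x' M) \<in> \<A>" unfolding \<A>_def by auto
      moreover have "M \<subseteq> span (insert x' M)" by (auto intro: span_base)
      ultimately have "span (insert x' M) = M" using max by blast
      then show False using x'M span_base[of x' "insert x' M"] by auto
    qed
  qed
  moreover have "span (insert v M) \<subseteq> carr X"
    using v Mc by (intro span_minimal) (auto simp: subspace_carr)
  ultimately show ?thesis using that closed vM by blast
qed

text \<open>
  Finite codimension of \<open>Y\<close> is inherited by its trace on any subspace \<open>U\<close>, with supplementary vectors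
  taken from \<open>U\<close> itself; hence intersections of finite-codimensional subspaces have finite
  codimension.
\<close>

lemma finite_codimension_inherited:
  assumes "finite B" "subspace U" "U \<subseteq> span (Y \<union> B)" "subspace Y"
  shows "\<exists>C. finite C \<and> C \<subseteq> U \<and> U \<subseteq> span ((U \<inter> Y) \<union> C)"
  using assms(1-3)
proof (induction B arbitrary: U)
  case empty
  then have "U \<subseteq> Y" using assms(4) by (simp add: span_subspace_id)
  then show ?case using span_superset[of U] by (intro exI[of _ "{}"]) (auto simp: Int_absorb2)
next
  case (insert b B)
  have "U \<subseteq> span (insert b (Y \<union> B))" using insert.prems by simp
  from subspace_in_span_insert[OF insert.prems(1) this]
  show ?case
  proof
    assume "U \<subseteq> span (Y \<union> B)"
    then show ?thesis using insert by blast
  next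
    assume "\<exists>e\<in>U. e \<notin> span (Y \<union> B) \<and> U = span (insert e (U \<inter> span (Y \<union> B)))"
    then obtain e where e: "e \<in> U" "U = span (insert e (U \<inter> span (Y \<union> B)))" by auto
    define V where "V = U \<inter> span (Y \<union> B)"
    have "subspace V" unfolding V_def using insert.prems by (simp add: subspace_inter)
    then obtain C where C: "finite C" "C \<subseteq> V" "V \<subseteq> span ((V \<inter> Y) \<union> C)"
      using insert.IH[of V] unfolding V_def by auto
    have "V \<subseteq> span ((U \<inter> Y) \<union> insert e C)"
      using C(3) span_mono[of "(V \<inter> Y) \<union> C" "(U \<inter> Y) \<union> insert e C"] unfolding V_def by blast
    then have "insert e V \<subseteq> span ((U \<inter> Y) \<union> insert e C)" by (auto intro: span_base)
    then have "U \<subseteq> span ((U \<inter> Y) \<union> insert e C)"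
      using e(2) span_minimal[OF _ subspace_span, of "insert e V" "(U \<inter> Y) \<union> insert e C"]
      unfolding V_def by simp
    then show ?thesis using C(1,2) e(1) unfolding V_def
      by (intro exI[of _ "insert e C"]) auto
  qed
qed

lemma fincodim_Int:
  assumes Y: "subspace Y" "Y \<subseteq> carr X" "fincodim X Y"
    and Z: "subspace Z" "Z \<subseteq> carr X" "fincodim X Z"
  shows "fincodim X (Y \<inter> Z)"
proof -
  obtain A B where A: "finite A" "span (Y \<union> A) = carr X" and B: "finite B" "span (Z \<union> B) = carr X"
    using Y Z unfolding fincodim_def by auto
  obtain C where C: "finite C" "C \<subseteq> Y" "Y \<subseteq> span ((Y \<inter> Z) \<union> C)"
    using finite_codimension_inherited[OF B(1) Y(1) _ Z(1)] Y(2) B(2) by auto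
  have Ac: "A \<subseteq> carr X" using span_superset[of "Y \<union> A"] A(2) by simp
  have "span ((Y \<inter> Z) \<union> C) \<subseteq> span ((Y \<inter> Z) \<union> (C \<union> A))"
    by (rule span_mono) auto
  moreover have "A \<subseteq> span ((Y \<inter> Z) \<union> (C \<union> A))"
    using span_superset[of "(Y \<inter> Z) \<union> (C \<union> A)"] by simp
  ultimately have "Y \<union> A \<subseteq> span ((Y \<inter> Z) \<union> (C \<union> A))"
    using C(3) by simp
  then have "carr X \<subseteq> span ((Y \<inter> Z) \<union> (C \<union> A))"
    using span_minimal[OF _ subspace_span, of "Y \<union> A" "(Y \<inter> Z) \<union> (C \<union> A)"] A(2) by simp
  moreover have "span ((Y \<inter> Z) \<union> (C \<union> A)) \<subseteq> carr X"
    using C Y Ac by (intro span_minimal) (auto simp: subspace_carr)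
  ultimately show ?thesis using A C unfolding fincodim_def
    by (intro exI[of _ "C \<union> A"]) auto
qed

lemma fincodim_not_findim:
  assumes "fincodim X Y" "\<not> findim (carr X)"
  shows "\<not> findim Y"
proof
  assume "findim Y"
  then obtain C where C: "finite C" "Y \<subseteq> span C" unfolding findim_def by auto
  obtain B where B: "finite B" "span (Y \<union> B) = carr X" using assms unfolding fincodim_def by auto
  have "Y \<union> B \<subseteq> span (C \<union> B)" using C(2) span_mono[of C "C \<union> B"] by (auto intro: span_base)
  then have "carr X \<subseteq> span (C \<union> B)" 
    using span_minimal[OF _ subspace_span, of "Y \<union> B" "C \<union> B"] B(2) by simp
  then show False using assms(2) B(1) C(1) unfolding findim_def by blast
qed

text \<open>
  One dimension at a time: if \<open>Y\<close> misses the span of \<open>B\<close>, it meets the span of \<open>B\<close> and \<open>b\<close> in at most a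
  line, which a closed hyperplane cuts off.
\<close>

lemma closed_fincodim_missing_findim:
  assumes "finite B" "B \<subseteq> carr X"
  shows "\<exists>Y. closed_subspace X Y \<and> fincodim X Y \<and> Y \<inter> span B \<subseteq> {0}"
  using assms
proof (induction B)
  case empty
  have "fincodim X (carr X)" unfolding fincodim_def
    by (intro exI[of _ "{}"]) (simp add: span_subspace_id subspace_carr)
  then show ?case using closed_subspace_carr by auto
next
  case (insert b B)
  then obtain Y where Y: "closed_subspace X Y" "fincodim X Y" "Y \<inter> span B \<subseteq> {0}" by auto
  note Y' = closed_subspaceD[OF Y(1)]
  show ?case
  proof (cases "Y \<inter> span (insert b B) \<subseteq> {0}")
    case True
    then show ?thesis using Y by auto
  next
    case False
    then obtain u where u: "u \<in> Y" "u \<in> span (insert b B)" "u \<noteq> 0" by auto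
    obtain Z where Z: "closed_subspace X Z" "u \<notin> Z" "span (insert u Z) = carr X"
      using closed_hyperplane_missing[of u] u Y' by blast
    note Z' = closed_subspaceD[OF Z(1)]
    have "fincodim X Z" unfolding fincodim_def using Z(3) by (intro exI[of _ "{u}"]) simp
    then have fin: "fincodim X (Y \<inter> Z)" using Y Y' Z' by (intro fincodim_Int)
    have "w = 0" if w: "w \<in> Y" "w \<in> Z" "w \<in> span (insert b B)" for w
    proof -
      obtain s where s: "u - s *\<^sub>R b \<in> span B" using u(2) span_breakdown_eq[of u b B] by blast
      obtain t where t: "w - t *\<^sub>R b \<in> span B" using w(3) span_breakdown_eq[of w b B] by blast
      have s0: "s \<noteq> 0" using s u Y(3) by auto
      have "(w - t *\<^sub>R b) - (t / s) *\<^sub>R (u - s *\<^sub>R b) \<in> span B"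
        by (rule span_diff[OF t span_scale[OF s]])
      then have "w - (t / s) *\<^sub>R u \<in> span B" using s0 by (simp add: algebra_simps)
      moreover have "w - (t / s) *\<^sub>R u \<in> Y"
        by (rule subspace_diff[OF Y'(1) w(1) subspace_scale[OF Y'(1) u(1)]])
      ultimately have weq: "w = (t / s) *\<^sub>R u" using Y(3) by auto
      have "t / s = 0"
      proof (rule ccontr)
        assume ts: "t / s \<noteq> 0"
        have "u = (1 / (t / s)) *\<^sub>R w" unfolding weq using ts by simp
        then show False using Z(2) subspace_scale[OF Z'(1) w(2)] by metis
      qed
      then show ?thesis using weq by simp
    qed
    then have "(Y \<inter> Z) \<inter> span (insert b B) \<subseteq> {0}" by auto
    then show ?thesis using fin closed_subspace_Int[OF Y(1) Z(1)] by blast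
  qed
qed

section \<open>Extending isomorphisms one dimension at a time\<close>

text \<open>
  Operators between subspaces are represented by linear maps on all of the ambient vector space, of
  which only the values on the subspace matter.
\<close>

definition embeds :: "real \<Rightarrow> real \<Rightarrow> ('v \<Rightarrow> 'v) \<Rightarrow> 'v set \<Rightarrow> bool" where
  "embeds a b \<phi> H \<longleftrightarrow> linear \<phi> \<and> \<phi> ` H \<subseteq> carr X \<and>
     (\<forall>u\<in>H. N (\<phi> u) \<le> a * N u \<and> N u \<le> b * N (\<phi> u))"

lemma embedsD:
  assumes "embeds a b \<phi> H"
  shows "linear \<phi>" "\<And>u. u \<in> H \<Longrightarrow> \<phi> u \<in> carr X"
    "\<And>u. u \<in> H \<Longrightarrow> N (\<phi> u) \<le> a * N u" "\<And>u. u \<in> H \<Longrightarrow> N u \<le> b * N (\<phi> u)"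
  using assms unfolding embeds_def by auto

lemma embeds_mono:
  assumes "embeds a b \<phi> H" "a \<le> a'" "b \<le> b'"
  shows "embeds a' b' \<phi> H"
proof -
  have "N (\<phi> u) \<le> a' * N u" "N u \<le> b' * N (\<phi> u)" if "u \<in> H" for u
    using embedsD(3,4)[OF assms(1) that] mult_right_mono[OF assms(2) N_nonneg[of u]]
      mult_right_mono[OF assms(3) N_nonneg[of "\<phi> u"]] by linarith+
  then show ?thesis using embedsD(1,2)[OF assms(1)] unfolding embeds_def by auto
qed

lemma embeds_id: "H \<subseteq> carr X \<Longrightarrow> embeds 1 1 (\<lambda>u. u) H"
  unfolding embeds_def using linear_ident by auto

lemma embeds_comp:
  assumes \<phi>: "embeds a b \<phi> H" and \<psi>: "embeds a' b' \<psi> (\<phi> ` H)" and nn: "0 \<le> a'" "0 \<le> b"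
  shows "embeds (a' * a) (b * b') (\<psi> \<circ> \<phi>) H"
proof -
  have "N (\<psi> (\<phi> u)) \<le> a' * a * N u" "N u \<le> b * b' * N (\<psi> (\<phi> u))" if u: "u \<in> H" for u
  proof -
    have "\<phi> u \<in> \<phi> ` H" using u by simp
    note 1 = embedsD(3,4)[OF \<phi> u] and 2 = embedsD(3,4)[OF \<psi> this]
    show "N (\<psi> (\<phi> u)) \<le> a' * a * N u"
      using 2(1) mult_left_mono[OF 1(1) nn(1)] by (simp add: mult.assoc)
    show "N u \<le> b * b' * N (\<psi> (\<phi> u))"
      using 1(2) mult_left_mono[OF 2(2) nn(2)] by (simp add: mult.assoc)
  qed
  moreover have "linear (\<psi> \<circ> \<phi>)" using embedsD(1) \<phi> \<psi> by (intro linear_compose)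
  ultimately show ?thesis using embedsD(2)[OF \<psi>] unfolding embeds_def by auto
qed

lemma embeds_inj:
  assumes "embeds a b \<phi> H" "subspace H" "H \<subseteq> carr X"
  shows "inj_on \<phi> H"
  unfolding linear_inj_on_iff_eq_0[OF embedsD(1)[OF assms(1)] assms(2)]
proof (intro ballI impI)
  fix x assume x: "x \<in> H" "\<phi> x = 0"
  have "N x \<le> 0" using embedsD(4)[OF assms(1) x(1)] x(2) N_zero by simp
  then have "N x = 0" using N_nonneg[of x] by simp
  then show "x = 0" using N_eq_0 x assms(3) by auto
qed

text \<open>
  Sending \<open>h + t e\<close> to \<open>\<phi> h + t e'\<close> is bounded in both directions, because the distance bounds
  control \<open>t\<close>, hence also the component \<open>h\<close>, by the norm of the sum.
\<close>

lemma embeds_insert: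
  assumes \<phi>: "embeds a b \<phi> H" and H: "subspace H" "H \<subseteq> carr X"
    and e: "e \<in> carr X" "e' \<in> carr X" and pos: "0 < \<rho>" "0 < \<rho>'" "0 \<le> a" "0 \<le> b"
    and far: "\<And>h. h \<in> H \<Longrightarrow> \<rho> \<le> N (e + h)" and far': "\<And>h. h \<in> \<phi> ` H \<Longrightarrow> \<rho>' \<le> N (e' + h)"
  obtains \<psi> where
    "embeds (a * (1 + N e / \<rho>) + N e' / \<rho>) (b * (1 + N e' / \<rho>') + N e / \<rho>') \<psi> (span (insert e H))"
    "\<psi> ` span (insert e H) = span (insert e' (\<phi> ` H))"
proof -
  have "e \<notin> H" using far[of "- e"] subspace_neg[OF H(1), of e] pos N_zero by auto
  then obtain \<tau> :: "'v \<Rightarrow> real" where \<tau>: "linear \<tau>" "\<And>h. h \<in> H \<Longrightarrow> \<tau> h = 0" "\<tau> e = 1"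
    using linear_functional_off_subspace[OF H(1)] by blast
  note lin = embedsD(1)[OF \<phi>]
  have H': "subspace (\<phi> ` H)" "\<phi> ` H \<subseteq> carr X"
    using linear_subspace_image[OF lin H(1)] embedsD(2)[OF \<phi>] by auto
  define \<psi> where "\<psi> u = \<phi> u + \<tau> u *\<^sub>R (e' - \<phi> e)" for u
  have "linear (\<lambda>u. \<tau> u *\<^sub>R (e' - \<phi> e))"
    by (rule linearI) (simp_all add: linear_add[OF \<tau>(1)] linear_scale[OF \<tau>(1)] scaleR_add_left)
  then have lin\<psi>: "linear \<psi>" unfolding \<psi>_def by (intro linear_compose_add lin)
  have val: "\<psi> (h + t *\<^sub>R e) = \<phi> h + t *\<^sub>R e'" if "h \<in> H" for h t
    unfolding \<psi>_def using that
    by (simp add: linear_add[OF \<tau>(1)] linear_scale[OF \<tau>(1)] linear_add[OF lin] linear_scale[OF lin]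
        \<tau> algebra_simps)
  have split: "u \<in> span (insert x V) \<longleftrightarrow> (\<exists>h\<in>V. \<exists>t. u = h + t *\<^sub>R x)" if "subspace V" for u x V
    unfolding span_breakdown_eq span_subspace_id[OF that]
  proof
    assume "\<exists>k. u - k *\<^sub>R x \<in> V"
    then obtain k where "u - k *\<^sub>R x \<in> V" by blast
    then show "\<exists>h\<in>V. \<exists>t. u = h + t *\<^sub>R x" by (intro bexI[of _ "u - k *\<^sub>R x"] exI[of _ k]) auto
  next
    assume "\<exists>h\<in>V. \<exists>t. u = h + t *\<^sub>R x"
    then obtain h t where "h \<in> V" "u = h + t *\<^sub>R x" by blast
    then show "\<exists>k. u - k *\<^sub>R x \<in> V" by (intro exI[of _ t]) simp
  qed
  have bounds: "N (\<psi> u) \<le> (a * (1 + N e / \<rho>) + N e' / \<rho>) * N u"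
    "N u \<le> (b * (1 + N e' / \<rho>') + N e / \<rho>') * N (\<psi> u)" "\<psi> u \<in> carr X"
    if u: "u \<in> span (insert e H)" for u
  proof -
    obtain h t where h: "h \<in> H" and ueq: "u = h + t *\<^sub>R e" using u split[OF H(1)] by blast
    have \<psi>u: "\<psi> u = \<phi> h + t *\<^sub>R e'" using val h ueq by simp
    have c: "h \<in> carr X" "\<phi> h \<in> carr X" using h H H' by auto
    show "\<psi> u \<in> carr X" unfolding \<psi>u using c e by (intro carr_simps)
    have uc: "u \<in> carr X" unfolding ueq using c e by (intro carr_simps)
    have general: "N (y + t *\<^sub>R f) \<le> (k * (1 + N g / r) + N f / r) * N (x + t *\<^sub>R g)"
      if c: "x \<in> carr X" "y \<in> carr X" "f \<in> carr X" "g \<in> carr X" and k: "0 \<le> k" "0 < r"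
        and le: "N y \<le> k * N x" and tr: "\<bar>t\<bar> * r \<le> N (x + t *\<^sub>R g)" for x y f g k r
    proof -
      define M where "M = N (x + t *\<^sub>R g)"
      have t: "\<bar>t\<bar> \<le> M / r" using tr k by (simp add: pos_le_divide_eq M_def)
      have tf: "\<bar>t\<bar> * N f \<le> M / r * N f" for f by (rule mult_right_mono[OF t N_nonneg])
      have "N x = N ((x + t *\<^sub>R g) - t *\<^sub>R g)" by simp
      also have "\<dots> \<le> M + N (t *\<^sub>R g)" unfolding M_def using c by (intro N_diff carr_simps)
      also have "\<dots> \<le> M + M / r * N g" using N_scale[of g t] c tf[of g] by simp
      finally have "k * N x \<le> k * (M + M / r * N g)" by (rule mult_left_mono[OF _ k(1)])
      moreover have "N (y + t *\<^sub>R f) \<le> N y + N (t *\<^sub>R f)" using c by (intro N_add carr_simps)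
      ultimately have "N (y + t *\<^sub>R f) \<le> k * (M + M / r * N g) + M / r * N f"
        using le N_scale[of f t] c tf[of f] by linarith
      also have "\<dots> = (k * (1 + N g / r) + N f / r) * M" by (simp add: algebra_simps)
      finally show ?thesis unfolding M_def .
    qed
    have "\<bar>t\<bar> * \<rho> \<le> N (h + t *\<^sub>R e)" by (rule coordinate_bound[OF H e(1) far h])
    from general[OF c e(2) e(1) pos(3) pos(1) embedsD(3)[OF \<phi> h] this]
    show "N (\<psi> u) \<le> (a * (1 + N e / \<rho>) + N e' / \<rho>) * N u" unfolding \<psi>u unfolding ueq .
    have "\<bar>t\<bar> * \<rho>' \<le> N (\<phi> h + t *\<^sub>R e')"
      by (rule coordinate_bound[OF H' e(2) far']) (use h in auto)
    from general[OF c(2,1) e pos(4) pos(2) embedsD(4)[OF \<phi> h] this]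
    show "N u \<le> (b * (1 + N e' / \<rho>') + N e / \<rho>') * N (\<psi> u)" unfolding \<psi>u unfolding ueq .
  qed
  have "embeds (a * (1 + N e / \<rho>) + N e' / \<rho>) (b * (1 + N e' / \<rho>') + N e / \<rho>') \<psi> (span (insert e H))"
    unfolding embeds_def using bounds lin\<psi> by blast
  moreover have "\<psi> ` span (insert e H) = span (insert e' (\<phi> ` H))"
  proof (intro subset_antisym subsetI)
    fix y assume "y \<in> \<psi> ` span (insert e H)"
    then obtain u where "u \<in> span (insert e H)" "y = \<psi> u" by blast
    then obtain h t where "h \<in> H" "y = \<psi> (h + t *\<^sub>R e)" using split[OF H(1), of u e] by blast
    then show "y \<in> span (insert e' (\<phi> ` H))" using val split[OF H'(1)] by auto
  next
    fix y assume "y \<in> span (insert e' (\<phi> ` H))"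
    then obtain h t where ht: "h \<in> H" "y = \<phi> h + t *\<^sub>R e'" using split[OF H'(1)] by auto
    then show "y \<in> \<psi> ` span (insert e H)"
      using val[OF ht(1)] split[OF H(1)] by (intro image_eqI[of _ _ "h + t *\<^sub>R e"]) auto
  qed
  ultimately show ?thesis by (rule that)
qed

lemma embeds_onto_isomorphic:
  assumes \<phi>: "embeds a b \<phi> H" and H: "subspace H" "H \<subseteq> carr X"
  shows "isomorphic_nspace (restrict_nspace X H) (restrict_nspace X (\<phi> ` H))"
proof -
  note lin = embedsD(1)[OF \<phi>]
  have inj: "inj_on \<phi> H" by (rule embeds_inj[OF \<phi> H])
  define T where "T = inv_into H \<phi>"
  have T\<phi>: "T (\<phi> u) = u" if "u \<in> H" for u unfolding T_def using inj that by simp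
  have R: "carr (restrict_nspace X V) = V" "\<And>u. u \<in> V \<Longrightarrow> nrm (restrict_nspace X V) u = N u" for V
    by (auto simp: restrict_nspace_def)
  have "bounded_op (restrict_nspace X H) (restrict_nspace X (\<phi> ` H)) \<phi>"
    unfolding bounded_op_def R using embedsD(3)[OF \<phi>] linear_add[OF lin] linear_scale[OF lin]
    by (auto simp: R intro!: exI[of _ a])
  moreover have "bounded_op (restrict_nspace X (\<phi> ` H)) (restrict_nspace X H) T"
    unfolding bounded_op_def R
  proof (intro conjI ballI allI exI[of _ b])
    show "T ` \<phi> ` H \<subseteq> H" using T\<phi> by auto
    fix g assume "g \<in> \<phi> ` H"
    then obtain u where u: "u \<in> H" "g = \<phi> u" by auto
    show "nrm (restrict_nspace X H) (T g) \<le> b * nrm (restrict_nspace X (\<phi> ` H)) g"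
      using u T\<phi> embedsD(4)[OF \<phi>] by (simp add: R)
    show "T (c *\<^sub>R g) = c *\<^sub>R T g" for c
      using u T\<phi> T\<phi>[OF subspace_scale[OF H(1) u(1), of c]] by (simp add: linear_scale[OF lin])
    fix h assume "h \<in> \<phi> ` H"
    then obtain v where v: "v \<in> H" "h = \<phi> v" by auto
    show "T (g + h) = T g + T h"
      using u v T\<phi> T\<phi>[OF subspace_add[OF H(1) u(1) v(1)]] by (simp add: linear_add[OF lin])
  qed
  ultimately show ?thesis unfolding isomorphic_nspace_def R
    by (intro exI[of _ \<phi>] exI[of _ T]) (auto simp: T\<phi>)
qed

text \<open>
  The recursion is the bound of \<open>embeds_insert\<close> for unit vectors \<open>e\<close>, \<open>e'\<close> at distance \<open>1/2\<close>:
  \<open>a (1 + 2) + 2\<close>.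
\<close>

primrec distortion :: "nat \<Rightarrow> real" where
  "distortion 0 = 1"
| "distortion (Suc m) = 3 * distortion m + 2"

lemma distortion_ge_1: "1 \<le> distortion m"
  by (induction m) auto

text \<open>
  A finite-dimensional space that lies in \<open>W\<close> up to \<open>m\<close> dimensions can be moved into \<open>W\<close> with a
  distortion that depends on \<open>m\<close> only: the missing dimensions are replaced one by one, with unit
  vectors at distance \<open>1/2\<close> from the previous ones that Riesz's lemma provides on both sides.
\<close>

lemma embeds_into_fincodim:
  assumes W: "closed_subspace X W" "\<not> findim W"
    and "finite B" "subspace E" "E \<subseteq> carr X" "findim E" "E \<subseteq> span (W \<union> B)"
  shows "\<exists>\<phi>. embeds (distortion (card B)) (distortion (card B)) \<phi> E \<and> \<phi> ` E \<subseteq> W"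
  using assms(3-7)
proof (induction B arbitrary: E)
  case empty
  have "E \<subseteq> W" using empty closed_subspaceD(1)[OF W(1)] by (simp add: span_subspace_id)
  then show ?case using embeds_id[of E] empty by (intro exI[of _ "\<lambda>u. u"]) simp
next
  case (insert b B)
  let ?D = "distortion (card B)"
  have D: "1 \<le> ?D" "distortion (card (insert b B)) = 3 * ?D + 2"
    using insert.hyps distortion_ge_1[of "card B"] by auto
  have "E \<subseteq> span (insert b (W \<union> B))" using insert.prems by simp
  from subspace_in_span_insert[OF insert.prems(1) this]
  show ?case
  proof
    assume "E \<subseteq> span (W \<union> B)"
    then obtain \<phi> where \<phi>: "embeds ?D ?D \<phi> E" "\<phi> ` E \<subseteq> W" using insert by blast
    show ?thesis
      using embeds_mono[OF \<phi>(1), of "3 * ?D + 2" "3 * ?D + 2"] \<phi>(2) D by auto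
  next
    assume "\<exists>e\<in>E. e \<notin> span (W \<union> B) \<and> E = span (insert e (E \<inter> span (W \<union> B)))"
    then obtain e0 where e0: "e0 \<in> E" "e0 \<notin> span (W \<union> B)"
      "E = span (insert e0 (E \<inter> span (W \<union> B)))" by blast
    define H where "H = E \<inter> span (W \<union> B)"
    have H: "subspace H" "H \<subseteq> carr X" "H \<subseteq> E" "H \<noteq> E" "findim H" "H \<subseteq> span (W \<union> B)"
      using insert.prems e0 findim_mono[OF insert.prems(3), of H]
      unfolding H_def by (auto simp: subspace_inter)
    obtain \<phi> where \<phi>: "embeds ?D ?D \<phi> H" "\<phi> ` H \<subseteq> W" using insert.IH[OF H(1,2,5,6)] by blast
    have "closed_subspace X H" by (rule findim_closed_subspace[OF H(1,2,5)])
    then obtain e where e: "e \<in> E" "N e = 1" "\<And>h. h \<in> H \<Longrightarrow> 1/2 \<le> N (e + h)"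
      using Riesz[OF _ H(3) insert.prems(1,2) H(4)] by blast
    have H': "subspace (\<phi> ` H)" "\<phi> ` H \<subseteq> carr X" "findim (\<phi> ` H)"
      using linear_subspace_image[OF embedsD(1)[OF \<phi>(1)] H(1)] embedsD(2)[OF \<phi>(1)]
        findim_image[OF embedsD(1)[OF \<phi>(1)] H(5)] by auto
    note W' = closed_subspaceD[OF W(1)]
    have "\<phi> ` H \<noteq> W" using H'(3) W(2) by auto
    then obtain e' where e': "e' \<in> W" "N e' = 1" "\<And>h. h \<in> \<phi> ` H \<Longrightarrow> 1/2 \<le> N (e' + h)"
      using Riesz[OF findim_closed_subspace[OF H'] \<phi>(2) W'(1,2)] by blast
    have eH: "e \<notin> H" using e(3)[of "- e"] subspace_neg[OF H(1), of e] N_zero by auto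
    have "e0 \<in> span (insert e H)"
      using in_span_insert[of e e0 H] e(1) e0(3) eH H(1)
      unfolding H_def[symmetric] by (simp add: span_subspace_id)
    then have "insert e0 H \<subseteq> span (insert e H)" by (auto intro: span_base)
    then have "E \<subseteq> span (insert e H)"
      using span_minimal[OF _ subspace_span, of "insert e0 H" "insert e H"] e0(3)
      unfolding H_def[symmetric] by simp
    moreover have "span (insert e H) \<subseteq> E" using e(1) H insert.prems by (intro span_minimal) auto
    ultimately have E: "span (insert e H) = E" by auto
    obtain \<psi> where \<psi>: "embeds (?D * (1 + 1 / (1/2)) + 1 / (1/2)) (?D * (1 + 1 / (1/2)) + 1 / (1/2)) \<psi> E"
        "\<psi> ` E = span (insert e' (\<phi> ` H))"
    proof (rule embeds_insert[OF \<phi>(1) H(1,2)])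
      show "e \<in> carr X" "e' \<in> carr X" using e(1) e'(1) insert.prems(2) W'(2) by auto
      show "0 \<le> ?D" "0 \<le> ?D" "0 < (1/2 :: real)" "0 < (1/2 :: real)" using D(1) by auto
      show "\<And>h. h \<in> H \<Longrightarrow> 1/2 \<le> N (e + h)" "\<And>h. h \<in> \<phi> ` H \<Longrightarrow> 1/2 \<le> N (e' + h)"
        by (fact e(3), fact e'(3))
    qed (simp add: E e(2) e'(2) that)
    have "\<psi> ` E \<subseteq> W" unfolding \<psi>(2) using e' \<phi>(2) W' by (intro span_minimal) auto
    moreover have "?D * (1 + 1 / (1/2)) + 1 / (1/2) = 3 * ?D + 2" by simp
    ultimately show ?thesis using \<psi>(1) unfolding D(2) by metis
  qed
qed

text \<open>
  An isomorphism of closed subspaces extends across complements of the same finite dimension. The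
  distances come from closedness alone, so the bounds depend on the spaces.
\<close>

lemma embeds_span_Un:
  assumes "finite A" "finite B" "card A = card B" "independent A" "independent B"
    "A \<subseteq> carr X" "B \<subseteq> carr X"
    and \<phi>: "embeds a b \<phi> Z" "0 \<le> a" "0 \<le> b"
    and Z: "closed_subspace X Z" "closed_subspace X (\<phi> ` Z)"
    and "span A \<inter> Z \<subseteq> {0}" "span B \<inter> \<phi> ` Z \<subseteq> {0}"
  shows "\<exists>a b \<psi>. 0 \<le> a \<and> 0 \<le> b \<and> embeds a b \<psi> (span (Z \<union> A)) \<and>
    \<psi> ` span (Z \<union> A) = span (\<phi> ` Z \<union> B)"
  using assms(1-7,13,14)
proof (induction A arbitrary: B)
  case empty
  then have "B = {}" by simp
  then show ?case using \<phi> Z closed_subspaceD(1) by (auto simp: span_subspace_id)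
next
  case (insert x A)
  obtain y C where B: "B = insert y C" "y \<notin> C" "card C = card A"
    using insert.prems(2) insert.hyps by (metis card_Suc_eq card_insert_disjoint)
  have sub: "span A \<subseteq> span (insert x A)" "span C \<subseteq> span B" unfolding B by (auto intro!: span_mono)
  have ind: "independent A" "independent C" "x \<notin> span A" "y \<notin> span C"
    using insert.prems(3,4) insert.hyps B by (auto simp: independent_insert)
  have fin: "finite C" using insert.prems B by auto
  have sub': "A \<subseteq> carr X" "C \<subseteq> carr X" "x \<in> carr X" "y \<in> carr X" using insert.prems B by auto
  obtain a b \<psi> where \<psi>: "0 \<le> a" "0 \<le> b" "embeds a b \<psi> (span (Z \<union> A))"
    "\<psi> ` span (Z \<union> A) = span (\<phi> ` Z \<union> C)"
    using insert.IH[OF fin B(3)[symmetric] ind(1,2) sub'(1,2)] insert.prems(7,8) sub by blast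
  \<comment> \<open>This is used on both sides of the isomorphism, to have positive distances there.\<close>
  have notin: "x \<notin> span (Z \<union> A)" if *: "closed_subspace X Z" "x \<notin> span A"
    "span (insert x A) \<inter> Z \<subseteq> {0}" for x A Z
  proof
    assume "x \<in> span (Z \<union> A)"
    then obtain z s where zs: "z \<in> Z" "s \<in> span A" "x = z + s"
      using closed_subspaceD(1)[OF *(1)] by (auto simp: span_Un span_subspace_id)
    have "s \<in> span (insert x A)" using zs(2) span_mono[of A "insert x A"] by auto
    then have "x - s \<in> span (insert x A)" by (intro span_diff) (auto intro: span_base)
    then have "z = 0" using zs *(3) by auto
    then show False using zs *(2) by simp
  qed
  have closed: "closed_subspace X (span (Z \<union> A))" "closed_subspace X (span (\<phi> ` Z \<union> C))"
    using closed_subspace_span_Un insert.hyps fin sub' Z by auto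
  obtain \<rho> where \<rho>: "0 < \<rho>" "\<And>h. h \<in> span (Z \<union> A) \<Longrightarrow> \<rho> \<le> N (x + h)"
    using closed_subspace_dist_pos[OF closed(1) sub'(3)] notin[OF Z(1) ind(3)] insert.prems by blast
  obtain \<rho>' where \<rho>': "0 < \<rho>'" "\<And>h. h \<in> span (\<phi> ` Z \<union> C) \<Longrightarrow> \<rho>' \<le> N (y + h)"
    using closed_subspace_dist_pos[OF closed(2) sub'(4)] notin[OF Z(2) ind(4)] insert.prems B by blast
  obtain \<theta> where \<theta>: "embeds (a * (1 + N x / \<rho>) + N y / \<rho>) (b * (1 + N y / \<rho>') + N x / \<rho>') \<theta>
      (span (insert x (span (Z \<union> A))))"
    "\<theta> ` span (insert x (span (Z \<union> A))) = span (insert y (span (\<phi> ` Z \<union> C)))"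
    using embeds_insert[OF \<psi>(3) closed_subspaceD(1,2)[OF closed(1)] sub'(3,4) \<rho>(1) \<rho>'(1) \<psi>(1,2) \<rho>(2)]
      \<rho>'(2) unfolding \<psi>(4) by blast
  have eq: "span (insert x (span S)) = span (insert x S)" for x and S :: "'v set"
    by (simp add: span_insert span_span)
  have "0 \<le> a * (1 + N x / \<rho>) + N y / \<rho>" "0 \<le> b * (1 + N y / \<rho>') + N x / \<rho>'"
    using \<psi>(1,2) \<rho>(1) \<rho>'(1) N_nonneg by auto
  then show ?case using \<theta> unfolding eq B by auto
qed

section \<open>Internal degrees as functions of finite-dimensional subspaces\<close>

lemma normed_restrict:
  assumes "subspace F" "F \<subseteq> carr X"
  shows "normed_space (restrict_nspace X F)"
  unfolding normed_space_def restrict_nspace_def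
  using assms N_nonneg N_eq_0 N_scale N_add
  by (auto simp: subspace_scale subspace_add subset_iff)

lemma banach_restrict:
  assumes X: "banach_space X" and F: "closed_subspace X F"
  shows "banach_space (restrict_nspace X F)"
proof -
  note F' = closed_subspaceD[OF F]
  have nR: "normed_space (restrict_nspace X F)" by (rule normed_restrict[OF F'(1,2)])
  interpret M: Metric_space "carr X" "ndist X" by (rule metric)
  have cR: "carr (restrict_nspace X F) = F" by (simp add: restrict_nspace_def)
  interpret R: Metric_space F "ndist (restrict_nspace X F)"
    using Metric_space_ndist[OF nR] unfolding cR .
  have dist: "ndist (restrict_nspace X F) x y = ndist X x y" if "x \<in> F" "y \<in> F" for x y
    using subspace_diff[OF F'(1) that] by (simp add: ndist_def restrict_nspace_def)
  have "\<exists>l. limitin R.mtopology \<sigma> l sequentially" if \<sigma>: "R.MCauchy \<sigma>" for \<sigma>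
  proof -
    have inF: "\<sigma> n \<in> F" for n using \<sigma> unfolding R.MCauchy_def by auto
    then have "M.MCauchy \<sigma>" using \<sigma> F'(2) unfolding R.MCauchy_def M.MCauchy_def by (auto simp: dist)
    then obtain l where l: "limitin M.mtopology \<sigma> l sequentially"
      using X unfolding banach_space_def M.mcomplete_def by blast
    have lim: "l \<in> carr X" "\<And>\<epsilon>. \<epsilon> > 0 \<Longrightarrow> \<exists>n0. \<forall>n\<ge>n0. ndist X (\<sigma> n) l < \<epsilon>"
      using l unfolding M.limit_metric_sequentially by blast+
    have "l \<in> F"
    proof (rule F'(3)[OF lim(1)])
      fix \<epsilon> :: real assume "\<epsilon> > 0"
      then obtain n where "ndist X (\<sigma> n) l < \<epsilon>" using lim(2) by blast
      then have "N (l - \<sigma> n) < \<epsilon>"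
        using N_commute[of l "\<sigma> n"] lim(1) inF[of n] F'(2) by (auto simp: ndist_def)
      then show "\<exists>y\<in>F. N (l - y) < \<epsilon>" using inF by blast
    qed
    then have "limitin R.mtopology \<sigma> l sequentially"
      unfolding R.limit_metric_sequentially using lim(2) inF by (simp add: dist)
    then show ?thesis by blast
  qed
  then show ?thesis unfolding banach_space_def cR R.mcomplete_def using nR by blast
qed

end

lemma op_norm_bound:
  assumes R: "normed_space R" and "0 \<le> C"
    and T: "\<And>u. u \<in> carr R \<Longrightarrow> nrm S (T u) \<le> C * nrm R u" "\<And>u. u \<in> carr R \<Longrightarrow> 0 \<le> nrm S (T u)"
  shows "op_norm R S T \<le> C" "0 \<le> op_norm R S T"
    "\<And>u. u \<in> carr R \<Longrightarrow> nrm S (T u) \<le> op_norm R S T * nrm R u"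
proof -
  interpret R: nsp R by (rule nsp.intro[OF R])
  have le: "nrm S (T u) / nrm R u \<le> C" if "u \<in> carr R" for u
  proof (cases "nrm R u = 0")
    case False
    then have "0 < nrm R u" using R.N_nonneg[of u] by linarith
    then show ?thesis using T(1)[OF that] by (simp add: pos_divide_le_eq)
  qed (use assms in auto)
  have bdd: "bdd_above ((\<lambda>u. nrm S (T u) / nrm R u) ` carr R)"
    using le by (auto intro!: bdd_aboveI)
  show "op_norm R S T \<le> C" unfolding op_norm_def
    using le R.carr_simps(4) by (intro cSUP_least) auto
  have upper: "nrm S (T u) / nrm R u \<le> op_norm R S T" if "u \<in> carr R" for u
    unfolding op_norm_def by (rule cSUP_upper[OF that bdd])
  show "0 \<le> op_norm R S T"
    using upper[OF R.carr_simps(4)] R.N_zero by simp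
  show "nrm S (T u) \<le> op_norm R S T * nrm R u" if u: "u \<in> carr R" for u
  proof (cases "nrm R u = 0")
    case True
    then show ?thesis using T(1)[OF u] by simp
  next
    case False
    then have "0 < nrm R u" using R.N_nonneg[of u] by linarith
    then show ?thesis using upper[OF u] by (simp add: pos_divide_le_eq)
  qed
qed

context nsp
begin

text \<open>
  An isomorphism and its inverse form a morphism between the spaces \<open>\<phi> ` F\<close> and \<open>F\<close>, each
  approximated by itself; internality lets the degrees be computed there instead of in \<open>X\<close>.
\<close>

lemma internal_degree_embeds:
  assumes X: "banach_space X"
    and K: "degree_modulus K"
    and deg: "\<And>X F Y G S T. approx_pair X F \<Longrightarrow> approx_pair Y G \<Longrightarrow> pair_morphism X F Y G S T \<Longrightarrow>
      d Y G \<le> K (morphism_norm X F Y G S T) (d X F)"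
    and nonneg: "\<And>X F. approx_pair X F \<Longrightarrow> 0 \<le> d X F"
    and internal: "\<And>X F. approx_pair X F \<Longrightarrow> d X F = \<delta> (restrict_nspace X F)"
    and F: "subspace F" "F \<subseteq> carr X" "findim F"
    and \<phi>: "embeds a b \<phi> F" and ab: "1 \<le> a" "1 \<le> b"
  shows "d X F \<le> K (a * b) (d X (\<phi> ` F))"
proof -
  define G where "G = \<phi> ` F"
  note lin = embedsD(1)[OF \<phi>]
  have G: "subspace G" "G \<subseteq> carr X" "findim G"
    unfolding G_def using linear_subspace_image[OF lin F(1)] embedsD(2)[OF \<phi>] findim_image[OF lin F(3)]
    by auto
  have inj: "inj_on \<phi> F" by (rule embeds_inj[OF \<phi> F(1,2)])
  define T where "T = inv_into F \<phi>"
  have T\<phi>: "T (\<phi> u) = u" if "u \<in> F" for u unfolding T_def using inj that by simp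
  have TG: "T g \<in> F" "\<phi> (T g) = g" if "g \<in> G" for g
    using that unfolding T_def G_def by (auto intro: inv_into_into f_inv_into_f)
  have self: "approx_pair (restrict_nspace X H) H" "d (restrict_nspace X H) H = d X H"
    if H: "subspace H" "H \<subseteq> carr X" "findim H" for H
  proof -
    have "approx_pair X H" using X H unfolding approx_pair_def by auto
    moreover show "approx_pair (restrict_nspace X H) H"
      using banach_restrict[OF X findim_closed_subspace[OF H]] H
      unfolding approx_pair_def by (auto simp: restrict_nspace_def)
    moreover have "restrict_nspace (restrict_nspace X H) H = restrict_nspace X H"
      by (auto simp: restrict_nspace_def)
    ultimately show "d (restrict_nspace X H) H = d X H" using internal by metis
  qed
  let ?F = "restrict_nspace X F" and ?G = "restrict_nspace X G"
  have R: "carr ?F = F" "carr ?G = G" "\<And>u. u \<in> F \<Longrightarrow> nrm ?F u = N u" "\<And>u. u \<in> G \<Longrightarrow> nrm ?G u = N u"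
    "restrict_nspace ?F F = ?F" "restrict_nspace ?G G = ?G"
    by (auto simp: restrict_nspace_def)
  have \<phi>G: "\<phi> u \<in> G" if "u \<in> F" for u using that by (simp add: G_def)
  have NT: "N (T g) \<le> b * N g" if "g \<in> G" for g using embedsD(4)[OF \<phi> TG(1)[OF that]] TG(2)[OF that] by simp
  have add: "T (g + h) = T g + T h" if "g \<in> G" "h \<in> G" for g h
  proof -
    have "g + h = \<phi> (T g + T h)" using TG(2) that linear_add[OF lin] by simp
    then show ?thesis using T\<phi> TG(1) that subspace_add[OF F(1)] by simp
  qed
  have scale: "T (c *\<^sub>R g) = c *\<^sub>R T g" if "g \<in> G" for g c
  proof -
    have "c *\<^sub>R g = \<phi> (c *\<^sub>R T g)" using TG(2) that linear_scale[OF lin] by simp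
    then show ?thesis using T\<phi> TG(1) that subspace_scale[OF F(1)] by simp
  qed
  have op\<phi>: "bounded_op ?F ?G \<phi>"
    unfolding bounded_op_def R using \<phi>G embedsD(3)[OF \<phi>] linear_add[OF lin] linear_scale[OF lin]
    by (auto simp: R intro!: exI[of _ a])
  have opT: "bounded_op ?G ?F T"
    unfolding bounded_op_def R using TG NT add scale by (auto simp: R intro!: exI[of _ b])
  have mor: "pair_morphism ?G G ?F F \<phi> T"
    unfolding pair_morphism_def R using op\<phi> opT T\<phi> by auto
  have nF: "normed_space ?F" and nG: "normed_space ?G" using normed_restrict F G by auto
  have b\<phi>: "op_norm ?F ?G \<phi> \<le> a" "0 \<le> op_norm ?F ?G \<phi>"
      "\<And>u. u \<in> F \<Longrightarrow> N (\<phi> u) \<le> op_norm ?F ?G \<phi> * N u"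
    using op_norm_bound[OF nF, of a ?G \<phi>] ab embedsD(3)[OF \<phi>] \<phi>G N_nonneg by (simp_all add: R)
  have bT: "op_norm ?G ?F T \<le> b" "0 \<le> op_norm ?G ?F T"
      "\<And>g. g \<in> G \<Longrightarrow> N (T g) \<le> op_norm ?G ?F T * N g"
    using op_norm_bound[OF nG, of b ?F T] ab NT TG N_nonneg by (simp_all add: R)
  define \<mu> where "\<mu> = morphism_norm ?G G ?F F \<phi> T"
  have \<mu>: "1 \<le> \<mu>" "\<mu> \<le> a * b"
  proof -
    have "1 \<le> a * b" using ab mult_mono[of 1 a 1 b] by simp
    moreover have "1 \<le> op_norm ?F ?G \<phi> * op_norm ?G ?F T" if "F \<noteq> {0}"
    proof -
      obtain g where g: "g \<in> F" "g \<noteq> 0" using \<open>F \<noteq> {0}\<close> subspace_0[OF F(1)] by auto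
      have "N g = N (T (\<phi> g))" using T\<phi> g by simp
      also have "\<dots> \<le> op_norm ?G ?F T * N (\<phi> g)" using bT(3) \<phi>G g by simp
      also have "\<dots> \<le> op_norm ?G ?F T * (op_norm ?F ?G \<phi> * N g)"
        using bT(2) b\<phi>(3) g by (intro mult_left_mono) auto
      finally have "1 * N g \<le> (op_norm ?F ?G \<phi> * op_norm ?G ?F T) * N g" by (simp add: mult_ac)
      then show ?thesis using N_pos g F(2) by (meson mult_le_cancel_right_pos subsetD)
    qed
    moreover have "op_norm ?F ?G \<phi> * op_norm ?G ?F T \<le> a * b"
      using b\<phi> bT ab by (intro mult_mono) auto
    ultimately show "1 \<le> \<mu>" "\<mu> \<le> a * b" unfolding \<mu>_def morphism_norm_def R by auto
  qed
  have dG: "0 \<le> d X G" using nonneg[of X G] X G unfolding approx_pair_def by auto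
  have "d X F = d ?F F" using self F by simp
  also have "\<dots> \<le> K \<mu> (d ?G G)" unfolding \<mu>_def using self F G mor by (intro deg)
  also have "d ?G G = d X G" using self G by simp
  also have "K \<mu> (d X G) \<le> K (a * b) (d X G)"
    using K dG \<mu> unfolding degree_modulus_def mono_on_def by auto
  finally show ?thesis unfolding G_def .
qed

end

text \<open>
  What the construction needs: \<open>deg F\<close> is the degree of \<open>F\<close>, and \<open>\<kappa>\<close> the constant of asymptotic
  smallness.
\<close>

locale large_asymptotically_small = nsp X for X :: "'v::real_vector nspace" +
  fixes deg :: "'v set \<Rightarrow> real" and K :: "real \<Rightarrow> real \<Rightarrow> real" and \<kappa> :: real
  assumes infinite_dim: "\<not> findim (carr X)"
    and modulus: "degree_modulus K"
    and deg_nonneg: "subspace F \<Longrightarrow> F \<subseteq> carr X \<Longrightarrow> findim F \<Longrightarrow> 0 \<le> deg F"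
    and deg_embeds: "subspace F \<Longrightarrow> F \<subseteq> carr X \<Longrightarrow> findim F \<Longrightarrow> embeds a b \<phi> F \<Longrightarrow> 1 \<le> a \<Longrightarrow> 1 \<le> b \<Longrightarrow>
      deg F \<le> K (a * b) (deg (\<phi> ` F))"
    and deg_large: "\<exists>F. subspace F \<and> F \<subseteq> carr X \<and> findim F \<and> C < deg F"
    and deg_small: "\<exists>W. closed_subspace X W \<and> fincodim X W \<and>
      (\<forall>F. subspace F \<and> F \<subseteq> W \<and> findim F \<and> dim F = n \<longrightarrow> deg F \<le> \<kappa>)"
    and \<kappa>_nonneg: "0 \<le> \<kappa>"
begin

lemma modulus_mono:
  assumes "1 \<le> s" "s \<le> s'" "0 \<le> t" "t \<le> t'"
  shows "K s t \<le> K s' t'"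
proof -
  have "K s t \<le> K s' t" using modulus assms unfolding degree_modulus_def mono_on_def by auto
  also have "\<dots> \<le> K s' t'" using modulus assms unfolding degree_modulus_def mono_on_def by auto
  finally show ?thesis .
qed

text \<open>
  Largeness passes to closed subspaces \<open>Y\<close> of finite codimension, because every finite-dimensional
  subspace can be moved into \<open>Y\<close> with uniformly bounded distortion.
\<close>

lemma deg_large_fincodim:
  assumes Y: "closed_subspace X Y" "fincodim X Y"
  obtains F where "subspace F" "F \<subseteq> Y" "findim F" "C < deg F"
proof -
  obtain B where B: "finite B" "span (Y \<union> B) = carr X" using Y(2) unfolding fincodim_def by auto
  let ?D = "distortion (card B)"
  have D: "1 \<le> ?D" by (rule distortion_ge_1)
  have DD: "1 \<le> ?D * ?D" using D mult_mono[of 1 ?D 1 ?D] by simp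
  \<comment> \<open>The maximum with \<open>0\<close> keeps the second argument in the range where \<open>K\<close> is monotone.\<close>
  obtain E where E: "subspace E" "E \<subseteq> carr X" "findim E" "K (?D * ?D) (max C 0) < deg E"
    using deg_large by blast
  obtain \<phi> where \<phi>: "embeds ?D ?D \<phi> E" "\<phi> ` E \<subseteq> Y"
    using embeds_into_fincodim[OF Y(1) fincodim_not_findim[OF Y(2) infinite_dim] B(1) E(1-3)] E(2) B(2)
    by auto
  have F: "subspace (\<phi> ` E)" "findim (\<phi> ` E)" "\<phi> ` E \<subseteq> carr X"
    using linear_subspace_image[OF embedsD(1)[OF \<phi>(1)] E(1)] findim_image[OF embedsD(1)[OF \<phi>(1)] E(3)]
      embedsD(2)[OF \<phi>(1)] by auto
  have "C < deg (\<phi> ` E)"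
  proof (rule ccontr)
    assume "\<not> C < deg (\<phi> ` E)"
    then have "K (?D * ?D) (deg (\<phi> ` E)) \<le> K (?D * ?D) (max C 0)"
      using DD deg_nonneg[OF F(1,3,2)] by (intro modulus_mono) auto
    moreover have "deg E \<le> K (?D * ?D) (deg (\<phi> ` E))" by (rule deg_embeds[OF E(1-3) \<phi>(1) D D])
    ultimately show False using E(4) by simp
  qed
  then show ?thesis using that F \<phi>(2) by blast
qed

section \<open>A sequence of pairs of blocks\<close>

text \<open>
  The spans of \<open>P\<close> and \<open>Q\<close> are two blocks of the same dimension in \<open>Y\<close>. The first one has a degree
  too large to embed, with distortion at most \<open>n\<close>, into a space that lies in \<open>W\<close> up to
  \<open>card B\<close> dimensions; the second one lies in \<open>W\<close>, where the subspaces of that dimension have degree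
  at most \<open>\<kappa>\<close>. The distortion is squared because it bounds a map and its inverse; the maximum keeps
  the argument of \<open>K\<close> at least \<open>1\<close> at stage \<open>0\<close>.
\<close>

definition block_pair :: "nat \<Rightarrow> 'v set \<Rightarrow> 'v set \<Rightarrow> 'v set \<Rightarrow> 'v set \<Rightarrow> 'v set \<Rightarrow> bool" where
  "block_pair n B Y P Q W \<longleftrightarrow>
     finite P \<and> finite Q \<and> card P = card Q \<and> independent P \<and> independent Q \<and>
     P \<subseteq> Y \<and> Q \<subseteq> Y \<and> Q \<subseteq> W \<and> closed_subspace X W \<and> fincodim X W \<and>
     K (max 1 (real n) * (distortion (card B))\<^sup>2) \<kappa> < deg (span P) \<and>
     (\<forall>F. subspace F \<and> F \<subseteq> W \<and> findim F \<and> dim F = card P \<longrightarrow> deg F \<le> \<kappa>)"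

lemma block_pair_exists:
  assumes Y: "closed_subspace X Y" "fincodim X Y"
  shows "\<exists>P Q W. block_pair n B Y P Q W"
proof -
  obtain F where F: "subspace F" "F \<subseteq> Y" "findim F"
    "K (max 1 (real n) * (distortion (card B))\<^sup>2) \<kappa> < deg F"
    using deg_large_fincodim[OF Y] by blast
  obtain P where P: "finite P" "independent P" "span P = F" using findim_basis[OF F(3,1)] by blast
  obtain W where W: "closed_subspace X W" "fincodim X W"
    "\<forall>F. subspace F \<and> F \<subseteq> W \<and> findim F \<and> dim F = card P \<longrightarrow> deg F \<le> \<kappa>"
    using deg_small by blast
  have "fincodim X (Y \<inter> W)" using Y W closed_subspaceD(1,2) by (intro fincodim_Int)
  then obtain Q where Q: "Q \<subseteq> Y \<inter> W" "independent Q" "finite Q" "card Q = card P"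
    using not_findim_independent[OF fincodim_not_findim[OF _ infinite_dim]] by blast
  have "P \<subseteq> Y" using P(3) F(2) span_superset[of P] by simp
  then show ?thesis unfolding block_pair_def using P Q W F(4)
    by (intro exI[of _ P] exI[of _ Q] exI[of _ W]) auto
qed

text \<open>
  Dependent choice. After each stage, \<open>Y\<close> is intersected with \<open>W\<close> and with a closed subspace of finite
  codimension that meets the span of everything chosen so far trivially.
\<close>

lemma block_sequence_exists:
  obtains P Q Y W where
    "\<And>n. block_pair n (\<Union>i<n. P i \<union> Q i) (Y n) (P n) (Q n) (W n)"
    "\<And>n. closed_subspace X (Y n)" "\<And>n. Y (Suc n) \<subseteq> Y n \<inter> W n"
    "\<And>n. Y n \<inter> span (\<Union>i<n. P i \<union> Q i) \<subseteq> {0}"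
proof -
  \<comment> \<open>A stage records the vectors chosen before (\<open>B\<close>), the current subspace and the current blocks.\<close>
  define good where "good n s = (case s of (B, Y, P, Q, W) \<Rightarrow>
      finite B \<and> B \<subseteq> carr X \<and> closed_subspace X Y \<and> fincodim X Y \<and> Y \<inter> span B \<subseteq> {0} \<and>
      block_pair n B Y P Q W)" for n s
  define next_stage where "next_stage s s' = (case s of (B, Y, P, Q, W) \<Rightarrow> case s' of (B', Y', _) \<Rightarrow>
      B' = B \<union> (P \<union> Q) \<and> Y' \<subseteq> Y \<inter> W)" for s s' :: "'v set \<times> 'v set \<times> 'v set \<times> 'v set \<times> 'v set"
  have codim_carr: "fincodim X (carr X)" unfolding fincodim_def
    by (intro exI[of _ "{}"]) (simp add: span_subspace_id subspace_carr)
  have "\<exists>s. (\<forall>n. good n (s n) \<and> next_stage (s n) (s (Suc n))) \<and> fst (s 0) = {}"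
  proof -
    define good' where "good' n s \<longleftrightarrow> good n s \<and> (n = 0 \<longrightarrow> fst s = {})" for n s
    have "\<exists>s. \<forall>n. good' n (s n) \<and> next_stage (s n) (s (Suc n))"
    proof (rule dependent_nat_choice)
      obtain P Q W where "block_pair 0 {} (carr X) P Q W"
        using block_pair_exists[OF closed_subspace_carr codim_carr] by blast
      then have "good' 0 ({}, carr X, P, Q, W)"
        unfolding good'_def good_def using closed_subspace_carr codim_carr by auto
      then show "\<exists>s. good' 0 s" by blast
    next
      fix s n assume "good' n s"
      then obtain B Y P Q W where s: "s = (B, Y, P, Q, W)" and g: "finite B" "B \<subseteq> carr X"
        "closed_subspace X Y" "fincodim X Y" "block_pair n B Y P Q W"
        unfolding good'_def good_def by (cases s) auto
      have bp: "finite P" "finite Q" "P \<subseteq> Y" "Q \<subseteq> Y" "closed_subspace X W" "fincodim X W"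
        using g(5) unfolding block_pair_def by auto
      define B' where "B' = B \<union> (P \<union> Q)"
      have B': "finite B'" "B' \<subseteq> carr X" unfolding B'_def using g bp closed_subspaceD(2)[OF g(3)] by auto
      obtain Z where Z: "closed_subspace X Z" "fincodim X Z" "Z \<inter> span B' \<subseteq> {0}"
        using closed_fincodim_missing_findim[OF B'] by blast
      define Y' where "Y' = (Y \<inter> W) \<inter> Z"
      have YW: "closed_subspace X (Y \<inter> W)" using closed_subspace_Int g bp by blast
      have "fincodim X (Y \<inter> W)" using g bp closed_subspaceD(1,2) by (intro fincodim_Int)
      then have Y': "closed_subspace X Y'" "fincodim X Y'"
        unfolding Y'_def using closed_subspace_Int[OF YW Z(1)] Z(2)
          fincodim_Int[OF closed_subspaceD(1,2)[OF YW] _ closed_subspaceD(1,2)[OF Z(1)]] by auto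
      obtain P' Q' W' where "block_pair (Suc n) B' Y' P' Q' W'" using block_pair_exists[OF Y'] by blast
      then have "good' (Suc n) (B', Y', P', Q', W')"
        unfolding good'_def good_def using B' Y' Z(3) by (auto simp: Y'_def)
      moreover have "next_stage s (B', Y', P', Q', W')"
        unfolding next_stage_def s by (auto simp: B'_def Y'_def)
      ultimately show "\<exists>s'. good' (Suc n) s' \<and> next_stage s s'" by blast
    qed
    then show ?thesis unfolding good'_def by blast
  qed
  then obtain s where s: "\<And>n. good n (s n)" "\<And>n. next_stage (s n) (s (Suc n))" "fst (s 0) = {}"
    by blast
  define B Y P Q W where "B n = fst (s n)" and "Y n = fst (snd (s n))" and "P n = fst (snd (snd (s n)))"
    and "Q n = fst (snd (snd (snd (s n))))" and "W n = snd (snd (snd (snd (s n))))" for n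
  have seq: "s n = (B n, Y n, P n, Q n, W n)" for n
    unfolding B_def Y_def P_def Q_def W_def by simp
  have B: "B n = (\<Union>i<n. P i \<union> Q i)" for n
  proof (induction n)
    case 0
    then show ?case using s(3) by (simp add: B_def)
  next
    case (Suc n)
    then show ?case using s(2)[of n] unfolding next_stage_def seq by (auto simp: lessThan_Suc)
  qed
  show ?thesis
    by (rule that[of P Q Y W]) (use s(1,2) in \<open>auto simp: good_def next_stage_def seq B\<close>)
qed

end


lemma isomorphic_nspace_commute: "isomorphic_nspace X Y \<longleftrightarrow> isomorphic_nspace Y X"
  unfolding isomorphic_nspace_def by blast

lemma E0_iff: "E0 x y \<longleftrightarrow> (\<exists>m. \<forall>n\<ge>m. x n = y n)"
  unfolding E0_def eventually_sequentially ..

locale block_sequence = large_asymptotically_small X deg K \<kappa>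
  for X :: "'v::real_vector nspace" and deg K \<kappa> +
  fixes P Q W Y :: "nat \<Rightarrow> 'v set"
  assumes blocks: "block_pair n (\<Union>i<n. P i \<union> Q i) (Y n) (P n) (Q n) (W n)"
    and Y_closed: "closed_subspace X (Y n)"
    and Y_Suc: "Y (Suc n) \<subseteq> Y n \<inter> W n"
    and Y_disjoint: "Y n \<inter> span (\<Union>i<n. P i \<union> Q i) \<subseteq> {0}"
begin

section \<open>The subspace attached to a binary sequence\<close>

abbreviation earlier :: "nat \<Rightarrow> 'v set" where "earlier n \<equiv> \<Union>i<n. P i \<union> Q i"

abbreviation block :: "(nat \<Rightarrow> bool) \<Rightarrow> nat \<Rightarrow> 'v set" where
  "block x n \<equiv> (if x n then P n else Q n)"

definition tail :: "(nat \<Rightarrow> bool) \<Rightarrow> nat \<Rightarrow> 'v set" where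
  "tail x n = cl (span (\<Union>i\<in>{n..}. block x i))"

lemma pair_facts:
  "finite (P n)" "finite (Q n)" "card (P n) = card (Q n)" "independent (P n)" "independent (Q n)"
  "P n \<subseteq> Y n" "Q n \<subseteq> Y n" "Q n \<subseteq> W n" "closed_subspace X (W n)" "fincodim X (W n)"
  "K (max 1 (real n) * (distortion (card (earlier n)))\<^sup>2) \<kappa> < deg (span (P n))"
  "\<And>F. subspace F \<Longrightarrow> F \<subseteq> W n \<Longrightarrow> findim F \<Longrightarrow> dim F = card (P n) \<Longrightarrow> deg F \<le> \<kappa>"
  using blocks[of n] unfolding block_pair_def by auto

lemma block_facts: "finite (block x n)" "independent (block x n)" "card (block x n) = card (P n)"
  "block x n \<subseteq> Y n"
  using pair_facts(1-7)[of n] by auto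

lemma Y_antimono: "m \<le> n \<Longrightarrow> Y n \<subseteq> Y m"
  by (induction rule: dec_induct) (use Y_Suc in auto)

lemma Y_carr: "Y n \<subseteq> carr X"
  using closed_subspaceD(2)[OF Y_closed] .

lemma block_carr: "block x n \<subseteq> carr X"
  using block_facts(4) Y_carr by blast

lemma finite_earlier: "finite (earlier n)"
  using pair_facts(1,2) by blast

lemma tail_span_carr: "span (\<Union>i\<in>{n..}. block x i) \<subseteq> carr X"
  using block_carr by (intro span_minimal subspace_carr) blast

lemma tail_closed: "closed_subspace X (tail x n)"
  unfolding tail_def using tail_span_carr by (intro closed_subspace_cl) auto

lemma tail_carr: "tail x n \<subseteq> carr X" and tail_subspace: "subspace (tail x n)"
  using closed_subspaceD[OF tail_closed] by auto

lemma tail_subset: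
  assumes "closed_subspace X Z" "\<And>i. n \<le> i \<Longrightarrow> block x i \<subseteq> Z"
  shows "tail x n \<subseteq> Z"
  unfolding tail_def
proof (rule cl_minimal[OF assms(1)])
  have "(\<Union>i\<in>{n..}. block x i) \<subseteq> Z"
    by (rule UN_least) (use assms(2) in simp)
  then show "span (\<Union>i\<in>{n..}. block x i) \<subseteq> Z"
    using closed_subspaceD(1)[OF assms(1)] by (rule span_minimal)
qed

lemma block_subset_tail:
  assumes "n \<le> i"
  shows "block x i \<subseteq> tail x n"
proof -
  have "block x i \<subseteq> span (\<Union>i\<in>{n..}. block x i)"
    using assms span_superset[of "\<Union>i\<in>{n..}. block x i"] by auto
  then show ?thesis unfolding tail_def using cl_superset[OF tail_span_carr] by blast
qed

lemma tail_subset_Y: "tail x n \<subseteq> Y n"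
  using block_facts(4) Y_antimono Y_closed by (intro tail_subset) blast+

lemma tail_subset_W:
  assumes "\<not> x n"
  shows "tail x n \<subseteq> W n"
proof (rule tail_subset[OF pair_facts(9)])
  fix i assume i: "n \<le> i"
  show "block x i \<subseteq> W n"
  proof (cases "i = n")
    case True
    then show ?thesis using assms pair_facts(8) by simp
  next
    case False
    then have "Y i \<subseteq> Y (Suc n)" using i by (intro Y_antimono) auto
    then show ?thesis using Y_Suc[of n] block_facts(4)[of x i] by blast
  qed
qed

lemma tail_antimono:
  assumes "m \<le> n"
  shows "tail x n \<subseteq> tail x m"
  using assms by (intro tail_subset tail_closed block_subset_tail) auto

lemma tail_Suc: "tail x n = span (tail x (Suc n) \<union> block x n)"
proof
  have sup: "tail x (Suc n) \<union> block x n \<subseteq> span (tail x (Suc n) \<union> block x n)"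
    by (rule span_superset)
  show "tail x n \<subseteq> span (tail x (Suc n) \<union> block x n)"
  proof (rule tail_subset)
    show "closed_subspace X (span (tail x (Suc n) \<union> block x n))"
      by (intro closed_subspace_span_Un block_facts block_carr tail_closed)
    fix i assume "n \<le> i"
    then consider "i = n" | "Suc n \<le> i" by linarith
    then show "block x i \<subseteq> span (tail x (Suc n) \<union> block x n)"
    proof cases
      case 1
      then show ?thesis using sup by (auto split: if_splits)
    next
      case 2
      then show ?thesis using sup block_subset_tail[OF 2] by blast
    qed
  qed
  show "span (tail x (Suc n) \<union> block x n) \<subseteq> tail x n"
    using tail_antimono[of n "Suc n" x] block_subset_tail[of n n x] tail_subspace
    by (intro span_minimal) auto
qed

lemma tail_0_subset: "tail x 0 \<subseteq> span (tail x n \<union> earlier n)"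
proof (induction n)
  case 0
  then show ?case using span_superset by auto
next
  case (Suc n)
  let ?S = "span (tail x (Suc n) \<union> earlier (Suc n))"
  have sup: "tail x (Suc n) \<union> earlier (Suc n) \<subseteq> ?S" by (rule span_superset)
  have "block x n \<subseteq> earlier (Suc n)" "earlier n \<subseteq> earlier (Suc n)" by (auto simp: lessThan_Suc)
  then have "tail x (Suc n) \<union> block x n \<subseteq> ?S" "earlier n \<subseteq> ?S" using sup by blast+
  then have "tail x n \<subseteq> ?S" "earlier n \<subseteq> ?S" unfolding tail_Suc[of x n] by (simp_all add: span_minimal)
  then have "span (tail x n \<union> earlier n) \<subseteq> ?S" by (intro span_minimal) auto
  then show ?case using Suc by blast
qed

section \<open>Sequences that are eventually equal give isomorphic subspaces\<close>

text \<open>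
  Downward induction from the index after which \<open>x\<close> and \<open>y\<close> agree: each step adds blocks of equal size
  to isomorphic tails, and the tails lie in \<open>Y (Suc n)\<close>, which meets the span of the blocks trivially.
\<close>

lemma tails_isomorphic:
  assumes eq: "\<And>i. m \<le> i \<Longrightarrow> x i = y i" and "n \<le> m"
  shows "\<exists>a b \<phi>. 0 \<le> a \<and> 0 \<le> b \<and> embeds a b \<phi> (tail x n) \<and> \<phi> ` tail x n = tail y n"
  using assms(2)
proof (induction rule: inc_induct)
  case base
  have "(\<Union>i\<in>{m..}. block x i) = (\<Union>i\<in>{m..}. block y i)" using eq by auto
  then have "tail x m = tail y m" unfolding tail_def by simp
  moreover have "embeds 1 1 (\<lambda>u. u) (tail x m)" using tail_carr by (rule embeds_id)
  ultimately show ?case by (intro exI[of _ 1] exI[of _ "\<lambda>u. u"]) simp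
next
  case (step n)
  then obtain a b \<phi> where \<phi>: "0 \<le> a" "0 \<le> b" "embeds a b \<phi> (tail x (Suc n))"
    "\<phi> ` tail x (Suc n) = tail y (Suc n)" by blast
  have disjoint: "span (block x n) \<inter> tail x (Suc n) \<subseteq> {0}" for x
  proof -
    have "span (block x n) \<subseteq> span (earlier (Suc n))" by (rule span_mono) auto
    then show ?thesis using tail_subset_Y[of x "Suc n"] Y_disjoint[of "Suc n"] by blast
  qed
  have "\<exists>a b \<psi>. 0 \<le> a \<and> 0 \<le> b \<and> embeds a b \<psi> (span (tail x (Suc n) \<union> block x n)) \<and>
      \<psi> ` span (tail x (Suc n) \<union> block x n) = span (\<phi> ` tail x (Suc n) \<union> block y n)"
    by (rule embeds_span_Un[where a = a and b = b])
      (simp_all only: block_facts block_carr \<phi> tail_closed disjoint not_False_eq_True)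
  then show ?case unfolding \<phi>(4) tail_Suc[of x n, symmetric] tail_Suc[of y n, symmetric] .
qed

lemma E0_imp_isomorphic:
  assumes "E0 x y"
  shows "isomorphic_nspace (restrict_nspace X (tail x 0)) (restrict_nspace X (tail y 0))"
proof -
  obtain m where "\<And>i. m \<le> i \<Longrightarrow> x i = y i" using assms unfolding E0_iff by blast
  then obtain a b \<phi> where "embeds a b \<phi> (tail x 0)" "\<phi> ` tail x 0 = tail y 0"
    using tails_isomorphic[of m x y 0] by auto
  then show ?thesis using embeds_onto_isomorphic tail_subspace tail_carr by metis
qed

section \<open>Isomorphic subspaces come from sequences that are eventually equal\<close>

text \<open>
  Let \<open>C\<close> bound the isomorphism and its inverse. The span of \<open>P n\<close> is carried first into the space of
  \<open>y\<close>, with distortion \<open>C\<^sup>2\<close>, and then into \<open>W n\<close>, with the distortion that the choice of \<open>P n\<close> took into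
  account; so its degree is at most the bound that it was chosen to exceed, as soon as \<open>C\<^sup>2 \<le> n\<close>.
\<close>

lemma isomorphic_imp_eventually_le:
  assumes "isomorphic_nspace (restrict_nspace X (tail x 0)) (restrict_nspace X (tail y 0))"
  shows "\<exists>m. \<forall>n\<ge>m. x n \<longrightarrow> y n"
proof -
  have R: "carr (restrict_nspace X V) = V" "\<And>u. u \<in> V \<Longrightarrow> nrm (restrict_nspace X V) u = N u" for V
    by (auto simp: restrict_nspace_def)
  obtain S T where S: "bounded_op (restrict_nspace X (tail x 0)) (restrict_nspace X (tail y 0)) S"
    and T: "bounded_op (restrict_nspace X (tail y 0)) (restrict_nspace X (tail x 0)) T"
    and TS: "\<And>u. u \<in> tail x 0 \<Longrightarrow> T (S u) = u"
    using assms unfolding isomorphic_nspace_def R by auto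
  have Sy: "S u \<in> tail y 0" if "u \<in> tail x 0" for u using S that unfolding bounded_op_def R by auto
  have Slin: "S (u + v) = S u + S v" "S (c *\<^sub>R u) = c *\<^sub>R S u"
    if "u \<in> tail x 0" "v \<in> tail x 0" for u v c
    using S that unfolding bounded_op_def R by auto
  obtain C1 where C1: "\<And>u. u \<in> tail x 0 \<Longrightarrow> N (S u) \<le> C1 * N u"
    using S Sy unfolding bounded_op_def R by (metis R(2))
  obtain C2 where C2: "\<And>u. u \<in> tail y 0 \<Longrightarrow> N (T u) \<le> C2 * N u"
    using T unfolding bounded_op_def R image_subset_iff by (metis R(2))
  define C where "C = max 1 (max C1 C2)"
  have C: "1 \<le> C" "C1 \<le> C" "C2 \<le> C" unfolding C_def by auto
  have up: "N (S u) \<le> C * N u" and low: "N u \<le> C * N (S u)" if u: "u \<in> tail x 0" for u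
    using C1[OF u] C2[OF Sy[OF u]] TS[OF u] mult_right_mono[OF C(2) N_nonneg[of u]]
      mult_right_mono[OF C(3) N_nonneg[of "S u"]] by auto
  obtain m :: nat where m: "C * C \<le> real m" using real_arch_simple by blast
  have "y n" if n: "m \<le> n" and xn: "x n" for n
  proof (rule ccontr)
    assume yn: "\<not> y n"
    let ?F = "span (P n)" and ?D = "distortion (card (earlier n))"
    \<comment> \<open>\<open>S\<close> is linear on the space of \<open>x\<close> only; \<open>\<sigma>\<close> is linear everywhere and agrees with it on the block.\<close>
    obtain \<sigma> where \<sigma>: "linear \<sigma>" "\<forall>u\<in>P n. \<sigma> u = S u"
      using linear_independent_extend[OF pair_facts(4)] by blast
    have Px: "P n \<subseteq> tail x 0" using block_subset_tail[of 0 n x] xn by simp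
    have "subspace {u \<in> tail x 0. \<sigma> u = S u}"
    proof (rule subspaceI)
      have 0: "0 \<in> tail x 0" using tail_subspace by (rule subspace_0)
      then show "0 \<in> {u \<in> tail x 0. \<sigma> u = S u}"
        using Slin(2)[OF 0 0, of 0] linear_0[OF \<sigma>(1)] by simp
    qed (auto simp: Slin subspace_add[OF tail_subspace] subspace_scale[OF tail_subspace]
        linear_add[OF \<sigma>(1)] linear_scale[OF \<sigma>(1)])
    then have "?F \<subseteq> {u \<in> tail x 0. \<sigma> u = S u}" using Px \<sigma>(2) by (intro span_minimal) auto
    then have F: "u \<in> tail x 0" "\<sigma> u = S u" if "u \<in> ?F" for u using that by auto
    have Fc: "?F \<subseteq> carr X" using F(1) tail_carr by blast
    have Ff: "findim ?F" unfolding findim_def using pair_facts(1) by blast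
    have \<sigma>emb: "embeds C C \<sigma> ?F"
      unfolding embeds_def using \<sigma>(1) F up low Sy tail_carr[of y 0] by auto
    define E where "E = \<sigma> ` ?F"
    have E: "subspace E" "findim E" "E \<subseteq> carr X"
      unfolding E_def using linear_subspace_image[OF \<sigma>(1)] findim_image[OF \<sigma>(1) Ff]
        embedsD(2)[OF \<sigma>emb] by auto
    have "tail y n \<union> earlier n \<subseteq> W n \<union> earlier n" using tail_subset_W[of y n, OF yn] by auto
    then have "span (tail y n \<union> earlier n) \<subseteq> span (W n \<union> earlier n)" by (rule span_mono)
    moreover have "E \<subseteq> tail y 0" unfolding E_def using F Sy by auto
    ultimately have "E \<subseteq> span (W n \<union> earlier n)" using tail_0_subset[of y n] by blast
    then obtain \<phi> where \<phi>: "embeds ?D ?D \<phi> E" "\<phi> ` E \<subseteq> W n"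
      using embeds_into_fincodim[OF pair_facts(9) fincodim_not_findim[OF pair_facts(10) infinite_dim]
          finite_earlier E(1,3,2)] by blast
    have D: "1 \<le> ?D" by (rule distortion_ge_1)
    let ?\<theta> = "\<phi> \<circ> \<sigma>"
    have \<theta>: "embeds (?D * C) (C * ?D) ?\<theta> ?F"
      using embeds_comp[OF \<sigma>emb, of ?D ?D \<phi>] \<phi>(1) D C(1) unfolding E_def by simp
    have inj: "inj_on ?\<theta> ?F" by (rule embeds_inj[OF \<theta> _ Fc]) simp
    have ind: "independent (?\<theta> ` P n)"
      by (rule linear_independent_injective_image[OF embedsD(1)[OF \<theta>] pair_facts(4) inj])
    have span\<theta>: "span (?\<theta> ` P n) = ?\<theta> ` ?F" by (rule linear_span_image[OF embedsD(1)[OF \<theta>]])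
    have "card (?\<theta> ` P n) = card (P n)"
      by (rule card_image[OF inj_on_subset[OF inj span_superset]])
    then have dim: "dim (?\<theta> ` ?F) = card (P n)"
      using dim_span_eq_card_independent[OF ind] unfolding span\<theta> by simp
    have \<theta>F: "subspace (?\<theta> ` ?F)" "findim (?\<theta> ` ?F)" "?\<theta> ` ?F \<subseteq> W n" "?\<theta> ` ?F \<subseteq> carr X"
      using linear_subspace_image[OF embedsD(1)[OF \<theta>]] findim_image[OF embedsD(1)[OF \<theta>] Ff]
        \<phi>(2) embedsD(2)[OF \<theta>] unfolding E_def by (auto simp: image_comp)
    have DC: "1 \<le> ?D * C" "1 \<le> C * ?D" using C(1) D mult_mono[of 1 ?D 1 C] by (auto simp: mult.commute)
    have "deg ?F \<le> K ((?D * C) * (C * ?D)) (deg (?\<theta> ` ?F))"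
      by (rule deg_embeds[OF _ Fc Ff \<theta> DC]) simp
    also have "\<dots> \<le> K (max 1 (real n) * ?D\<^sup>2) \<kappa>"
    proof (rule modulus_mono)
      show "1 \<le> (?D * C) * (C * ?D)" using DC mult_mono[of 1 "?D * C" 1 "C * ?D"] by simp
      have "C * C \<le> max 1 (real n)" using m n by linarith
      then have "(C * C) * ?D\<^sup>2 \<le> max 1 (real n) * ?D\<^sup>2" by (rule mult_right_mono) simp
      then show "(?D * C) * (C * ?D) \<le> max 1 (real n) * ?D\<^sup>2"
        by (simp add: power2_eq_square mult_ac)
      show "0 \<le> deg (?\<theta> ` ?F)" by (rule deg_nonneg[OF \<theta>F(1,4,2)])
      show "deg (?\<theta> ` ?F) \<le> \<kappa>" by (rule pair_facts(12)[OF \<theta>F(1,3,2) dim])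
    qed
    finally show False using pair_facts(11)[of n] by simp
  qed
  then show ?thesis by blast
qed

lemma isomorphic_imp_E0:
  assumes "isomorphic_nspace (restrict_nspace X (tail x 0)) (restrict_nspace X (tail y 0))"
  shows "E0 x y"
proof -
  obtain m where m: "\<forall>n\<ge>m. x n \<longrightarrow> y n" using isomorphic_imp_eventually_le[OF assms] by blast
  obtain m' where m': "\<forall>n\<ge>m'. y n \<longrightarrow> x n"
    using isomorphic_imp_eventually_le[of y x] assms isomorphic_nspace_commute by blast
  have "\<forall>n\<ge>max m m'. x n = y n" using m m' by auto
  then show ?thesis unfolding E0_iff by blast
qed

section \<open>Measurability\<close>

text \<open>
  The space of \<open>x\<close> meets an open set iff the span of finitely many of its blocks does, a condition on
  finitely many terms of \<open>x\<close>.
\<close>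

lemma open_tail_meets:
  assumes U: "openin (ntop X) U"
  shows "open {x. tail x 0 \<inter> U \<noteq> {}}"
proof (rule topological_space_class.openI)
  fix x assume "x \<in> {x. tail x 0 \<inter> U \<noteq> {}}"
  then obtain u where u: "u \<in> tail x 0" "u \<in> U" by auto
  obtain r where r: "r > 0" "\<And>v. v \<in> carr X \<Longrightarrow> N (u - v) < r \<Longrightarrow> v \<in> U"
    using U u(2) unfolding openin_ntop by blast
  obtain v where v: "v \<in> span (\<Union>i\<in>{0..}. block x i)" "N (u - v) < r"
    using u(1) r(1) unfolding tail_def cl_def by blast
  have vU: "v \<in> U" using v r(2) tail_span_carr by blast
  have "{0::nat..} = UNIV" by auto
  then obtain m where m: "v \<in> span (\<Union>i<m. block x i)"
    using span_Union_finite_stage v(1) by metis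
  have "tail z 0 \<inter> U \<noteq> {}" if z: "\<forall>i\<in>{..<m}. z i \<in> {x i}" for z
  proof -
    have "(\<Union>i<m. block x i) \<subseteq> tail z 0"
    proof (rule UN_least)
      fix i assume "i \<in> {..<m}"
      then have "block x i = block z i" using z by auto
      then show "block x i \<subseteq> tail z 0" using block_subset_tail[of 0 i z] by simp
    qed
    then have "span (\<Union>i<m. block x i) \<subseteq> tail z 0" using tail_subspace by (rule span_minimal)
    then show ?thesis using m vU by blast
  qed
  moreover have "open {z. \<forall>i\<in>{..<m}. z i \<in> {x i}}"
    by (rule product_topology_basis') (auto simp: open_discrete)
  ultimately show "\<exists>V. open V \<and> x \<in> V \<and> V \<subseteq> {x. tail x 0 \<inter> U \<noteq> {}}"
    by (intro exI[of _ "{z. \<forall>i\<in>{..<m}. z i \<in> {x i}}"]) auto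
qed

lemma tail_measurable: "(\<lambda>x. tail x 0) \<in> borel \<rightarrow>\<^sub>M effros X"
  unfolding effros_def
proof (rule measurable_measure_of)
  show "(\<lambda>x. tail x 0) \<in> space borel \<rightarrow> Sub X" using tail_closed by (auto simp: Sub_def)
next
  fix A assume "A \<in> {{Z \<in> Sub X. Z \<inter> U \<noteq> {}} |U. openin (ntop X) U}"
  then obtain U where U: "openin (ntop X) U" "A = {Z \<in> Sub X. Z \<inter> U \<noteq> {}}" by auto
  have "(\<lambda>x. tail x 0) -` A \<inter> space borel = {x. tail x 0 \<inter> U \<noteq> {}}"
    using tail_closed by (auto simp: U(2) Sub_def)
  then show "(\<lambda>x. tail x 0) -` A \<inter> space borel \<in> sets borel" using open_tail_meets[OF U(1)] by simp
qed auto

lemma ergodic: "ergodic X"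
  unfolding ergodic_def
  using tail_measurable E0_imp_isomorphic isomorphic_imp_E0 by (intro bexI[of _ "\<lambda>x. tail x 0"]) blast+

end

lemma (in large_asymptotically_small) ergodic: "ergodic X"
proof -
  obtain P Q Y W where
    "\<And>n. block_pair n (\<Union>i<n. P i \<union> Q i) (Y n) (P n) (Q n) (W n)"
    "\<And>n. closed_subspace X (Y n)" "\<And>n. Y (Suc n) \<subseteq> Y n \<inter> W n"
    "\<And>n. Y n \<inter> span (\<Union>i<n. P i \<union> Q i) \<subseteq> {0}"
    by (rule block_sequence_exists) blast
  then interpret block_sequence X deg K \<kappa> P Q W Y by unfold_locales
  show ?thesis by (rule ergodic)
qed

theorem theorem5p25:
  fixes d :: "'v::real_vector nspace \<Rightarrow> 'v set \<Rightarrow> real"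
  assumes "internal_degree d"
  shows "\<forall>X. banach_space X \<and> \<not> findim (carr X) \<and> separable_nspace X \<and>
           d_large d X \<and> asymptotically_d_small d X \<longrightarrow> ergodic X"
proof (intro allI impI, elim conjE)
  fix X :: "'v nspace"
  assume X: "banach_space X" and inf: "\<not> findim (carr X)"
    and large: "d_large d X" and small: "asymptotically_d_small d X"
  obtain K where K: "degree_modulus K" and nonneg: "\<And>X F. approx_pair X F \<Longrightarrow> 0 \<le> d X F"
    and deg: "\<And>X F Y G S T. approx_pair X F \<Longrightarrow> approx_pair Y G \<Longrightarrow> pair_morphism X F Y G S T \<Longrightarrow>
      d Y G \<le> K (morphism_norm X F Y G S T) (d X F)"
    using assms unfolding internal_degree_def is_degree_def by blast
  obtain \<delta> where internal: "\<And>X F. approx_pair X F \<Longrightarrow> d X F = \<delta> (restrict_nspace X F)"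
    using assms unfolding internal_degree_def by blast
  obtain \<kappa> where \<kappa>: "\<And>n. \<exists>W. closed_subspace X W \<and> fincodim X W \<and>
      (\<forall>F. subspace F \<and> F \<subseteq> W \<and> findim F \<and> dim F = n \<longrightarrow> d X F \<le> \<kappa>)"
    using small unfolding asymptotically_d_small_def by blast
  interpret nsp X using X by unfold_locales (simp add: banach_space_def)
  \<comment> \<open>The constant may be enlarged, so it may be taken nonnegative, where \<open>K\<close> is monotone.\<close>
  interpret large_asymptotically_small X "d X" K "max \<kappa> 0"
  proof unfold_locales
    fix F assume "subspace F" "F \<subseteq> carr X" "findim F"
    then show "0 \<le> d X F" using X by (intro nonneg) (simp add: approx_pair_def)
  next
    fix F a b \<phi>
    assume F: "subspace F" "F \<subseteq> carr X" "findim F" "embeds a b \<phi> F" "1 \<le> a" "1 \<le> b"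
    show "d X F \<le> K (a * b) (d X (\<phi> ` F))"
      by (rule internal_degree_embeds[where d = d, OF X K deg nonneg internal F])
  next
    fix C
    show "\<exists>F. subspace F \<and> F \<subseteq> carr X \<and> findim F \<and> C < d X F"
      using large unfolding d_small_def bdd_above_def approx_pair_def by (auto simp: not_le)
  next
    fix n
    show "\<exists>W. closed_subspace X W \<and> fincodim X W \<and>
        (\<forall>F. subspace F \<and> F \<subseteq> W \<and> findim F \<and> dim F = n \<longrightarrow> d X F \<le> max \<kappa> 0)"
      using \<kappa>[of n] by (meson le_max_iff_disj)
  qed (use inf K in auto)
  show "ergodic X" by (rule ergodic)
qed

end
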